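(* Let $d\ge 2$, let $K\subset\mathbb{R}^d$ be a convex body, and let $\varphi$ be an even Borel probability measure on $\mathbb{S}^{d-1}$ that is not concentrated on a great subsphere. Let $X_n$, $n\in\mathbb{N}$, be the stationary Poisson hyperplane processes with intensity $n$ and directional distribution $\varphi$ defined on a common probability space as in the context, and let $Z_K^{(n)}$ be the $K$-cell of $X_n$. Suppose that there is a constant $b>0$ such that at least one of the following two conditions holds: (A) $\varphi\ge b\,\sigma$; (B) $\varphi\ge b\,S_{d-1}(K,\cdot)$. Then $$\delta(K,Z_K^{(n)})=\mathrm{O}\left(\left(\frac{\log n}{n}\right)^{1/d}\right)\quad\text{almost surely, as } n\to\infty. \qquad ( * )$$ Suppose that (B) holds for some $b>0$. If a ball slides freely inside $K$, then the exponent $1/d$ in $( * )$ can be replaced by $2/(d+1)$; and if $K$ is a polytope, then the exponent $1/d$ in $( * )$ can be replaced by $1$.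
   Context: A convex body is a compact convex subset of $\mathbb{R}^d$ with nonempty interior. A ball is a Euclidean ball of positive radius. A convex body $M$ slides freely inside a convex body $K$ if $K$ is the union of all translates of $M$ that are contained in $K$. $\delta$ is the Hausdorff metric (Euclidean norm), $\sigma$ is spherical Lebesgue measure on the unit sphere $\mathbb{S}^{d-1}$, and $S_{d-1}(K,\cdot)$ is the surface area measure of $K$ on $\mathbb{S}^{d-1}$: $S_{d-1}(K,\omega)$ is the $(d-1)$-dimensional Hausdorff measure of the set of boundary points of $K$ having an outer unit normal vector in the Borel set $\omega$. Inequalities between measures are meant setwise. Let $\mathcal{H}^d$ be the space of hyperplanes in $\mathbb{R}^d$, $H(u,t)=\{x\in\mathbb{R}^d:\langle x,u\rangle=t\}$, and for $\gamma>0$ let $$\Theta_\gamma(A)=2\gamma\int_{\mathbb{S}^{d-1}}\int_0^\infty \mathbf{1}_A(H(u,t))\,dt\,\varphi(du),\qquad A\in\mathcal{B}(\mathcal{H}^d).$$ Let $\xi$ be a Poisson process on $[0,\infty)\times\mathcal{H}^d$ with intensity measure $\lambda\otimes\Theta_1$, where $\lambda$ is Lebesgue measure on $[0,\infty)$, and put $X_n:=\xi([0,n]\times\cdot)$; this is a stationary Poisson hyperplane process with intensity $n$, directional distribution $\varphi$ and intensity measure $\Theta_n$, identified with its support, a locally finite random set of hyperplanes. For a hyperplane $H$ with $H\cap K=\emptyset$, let $H^-_K$ be the closed halfspace bounded by $H$ that contains $K$. The $K$-cell of $X_n$ is the (almost surely bounded) random polytope $Z_K^{(n)}=\bigcap_{H\in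 X_n,\,H\cap K=\emptyset}H^-_K$. For real random variables $Y_n$ and nonnegative reals $f(n)$, "$Y_n=\mathrm{O}(f(n))$ almost surely" means that there is a (deterministic) constant $C<\infty$ such that with probability one $Y_n\le Cf(n)$ for all sufficiently large $n$. *)

theory Defs
  imports "HOL-Probability.Probability"
begin

section \<open>Convex bodies\<close>

definition convex_body :: "'a::euclidean_space set \<Rightarrow> bool" where
  "convex_body K \<longleftrightarrow> compact K \<and> convex K \<and> interior K \<noteq> {}"

definition slides_freely_inside :: "'a::euclidean_space set \<Rightarrow> 'a set \<Rightarrow> bool" where
  "slides_freely_inside M K \<longleftrightarrow> K = \<Union>{(+) x ` M | x. (+) x ` M \<subseteq> K}"

text \<open>A real number for nonempty bounded sets; for unbounded sets the value is
  meaningless.\<close>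

definition hausdorff_distance :: "'a::metric_space set \<Rightarrow> 'a set \<Rightarrow> real" where
  "hausdorff_distance A B = max (SUP x\<in>A. infdist x B) (SUP x\<in>B. infdist x A)"


section \<open>Measures on the sphere\<close>

text \<open>The \<open>k\<close>-dimensional Hausdorff (outer) measure, normalised to agree with Lebesgue measure
  on \<open>k\<close>-dimensional Euclidean space. The case distinction on \<open>C i = {}\<close> only matters
  for \<open>k = 0\<close>, where \<open>0 ^ k = 1\<close>.\<close>

definition hausdorff_premeasure :: "nat \<Rightarrow> real \<Rightarrow> 'a::metric_space set \<Rightarrow> ennreal" where
  "hausdorff_premeasure k \<epsilon> A =
     (INF C \<in> {C :: nat \<Rightarrow> 'a set. A \<subseteq> (\<Union>i. C i) \<and> (\<forall>i. bounded (C i) \<and> diameter (C i) \<le> \<epsilon>)}.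
        \<Sum>i. if C i = {} then 0
            else ennreal (unit_ball_vol (real k) * (diameter (C i) / 2) ^ k))"

definition hausdorff_measure :: "nat \<Rightarrow> 'a::metric_space set \<Rightarrow> ennreal" where
  "hausdorff_measure k A = (SUP \<epsilon>\<in>{0<..}. hausdorff_premeasure k \<epsilon> A)"

abbreviation unit_sphere :: "'a::euclidean_space set" where
  "unit_sphere \<equiv> sphere 0 1"

abbreviation sphere_borel :: "'a::euclidean_space measure" where
  "sphere_borel \<equiv> restrict_space borel unit_sphere"

text \<open>Spherical Lebesgue measure, as \<open>d\<close> times the volume of the cone over the given set
  (polar coordinates).\<close>

definition spherical_lebesgue :: "'a::euclidean_space set \<Rightarrow> ennreal" where
  "spherical_lebesgue \<omega> =
     of_nat DIM('a) * emeasure lborel {s *\<^sub>R u | s u. 0 \<le> s \<and> s \<le> 1 \<and> u \<in> \<omega>}"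

definition outer_unit_normal :: "'a::euclidean_space set \<Rightarrow> 'a \<Rightarrow> 'a \<Rightarrow> bool" where
  "outer_unit_normal K x u \<longleftrightarrow> norm u = 1 \<and> (\<forall>y\<in>K. (y - x) \<bullet> u \<le> 0)"

definition surface_area_measure :: "'a::euclidean_space set \<Rightarrow> 'a set \<Rightarrow> ennreal" where
  "surface_area_measure K \<omega> =
     hausdorff_measure (DIM('a) - 1) {x \<in> frontier K. \<exists>u\<in>\<omega>. outer_unit_normal K x u}"

definition even_measure :: "'a::euclidean_space measure \<Rightarrow> bool" where
  "even_measure \<phi> \<longleftrightarrow> (\<forall>A\<in>sets \<phi>. emeasure \<phi> (uminus ` A) = emeasure \<phi> A)"

definition concentrated_on_great_subsphere :: "'a::euclidean_space measure \<Rightarrow> bool" where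
  "concentrated_on_great_subsphere \<phi> \<longleftrightarrow> (\<exists>v. norm v = 1 \<and> (AE u in \<phi>. u \<bullet> v = 0))"

text \<open>The setwise inequality \<open>\<phi> \<ge> b m\<close>, for a set function \<open>m\<close>.\<close>

definition setwise_ge :: "'b measure \<Rightarrow> real \<Rightarrow> ('b set \<Rightarrow> ennreal) \<Rightarrow> bool" where
  "setwise_ge \<phi> b m \<longleftrightarrow> (\<forall>A\<in>sets \<phi>. emeasure \<phi> A \<ge> ennreal b * m A)"


section \<open>The space of hyperplanes\<close>

definition hyperplane :: "'a::euclidean_space \<Rightarrow> real \<Rightarrow> 'a set" where
  "hyperplane u t = {x. x \<bullet> u = t}"

definition hyperplanes :: "'a::euclidean_space set set" where
  "hyperplanes = {hyperplane u t | u t. norm u = 1}"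

text \<open>The usual topology on the space of hyperplanes: the finest one for which
  \<open>(u, t) \<mapsto> hyperplane u t\<close> is continuous on the product of the unit sphere and the real
  line. On hyperplanes it coincides with the topology of closed convergence (Fell topology).\<close>

definition hyperplane_topology :: "'a::euclidean_space set topology" where
  "hyperplane_topology = topology (\<lambda>U. U \<subseteq> hyperplanes \<and>
     openin (top_of_set (unit_sphere \<times> UNIV)) {(u, t). norm u = 1 \<and> hyperplane u t \<in> U})"

lemma openin_hyperplane_topology:
  fixes U :: "'a::euclidean_space set set"
  shows "openin hyperplane_topology U \<longleftrightarrow> U \<subseteq> hyperplanes \<and>
    openin (top_of_set (unit_sphere \<times> UNIV)) {(u, t). norm u = 1 \<and> hyperplane u t \<in> U}"
proof -
  define P where "P = (\<lambda>U :: 'a set set. {(u, t). norm u = 1 \<and> hyperplane u t \<in> U})"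
  have Int: "P (S \<inter> T) = P S \<inter> P T" for S T by (auto simp: P_def)
  have Un: "P (\<Union>\<K>) = (\<Union>S\<in>\<K>. P S)" for \<K> by (auto simp: P_def)
  have "istopology (\<lambda>U. U \<subseteq> hyperplanes \<and> openin (top_of_set (unit_sphere \<times> UNIV)) (P U))"
    unfolding istopology_def Int Un by blast
  then show ?thesis
    by (simp add: hyperplane_topology_def P_def)
qed

lemma topspace_hyperplane_topology:
  "topspace hyperplane_topology = (hyperplanes :: 'a::euclidean_space set set)"
proof -
  have *: "{(u :: 'a, t). norm u = 1 \<and> hyperplane u t \<in> hyperplanes} = unit_sphere \<times> UNIV"
    by (auto simp: hyperplanes_def)
  have "openin hyperplane_topology (hyperplanes :: 'a set set)"
    unfolding openin_hyperplane_topology * by auto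
  then show ?thesis
    by (metis openin_hyperplane_topology openin_subset openin_topspace subset_antisym)
qed

definition borel_of :: "'b topology \<Rightarrow> 'b measure" where
  "borel_of T = sigma (topspace T) {U. openin T U}"

definition hyperplane_measure :: "'a::euclidean_space measure \<Rightarrow> real \<Rightarrow> 'a set measure" where
  "hyperplane_measure \<phi> \<gamma> =
     measure_of hyperplanes (sets (borel_of hyperplane_topology))
       (\<lambda>A. ennreal (2 * \<gamma>) *
          (\<integral>\<^sup>+u. (\<integral>\<^sup>+t\<in>{0..}. indicator A (hyperplane u t) \<partial>lborel) \<partial>\<phi>))"


section \<open>Poisson processes\<close>

text \<open>A measure is identified with its topological support; for a locally finite counting
  measure this is the set of its atoms.\<close>

definition measure_support :: "'b topology \<Rightarrow> 'b measure \<Rightarrow> 'b set" where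
  "measure_support T \<nu> =
     {x \<in> topspace T. \<forall>U. openin T U \<and> x \<in> U \<longrightarrow> emeasure \<nu> U > 0}"

definition locally_finite_counting_measure :: "'b topology \<Rightarrow> 'b measure \<Rightarrow> bool" where
  "locally_finite_counting_measure T \<nu> \<longleftrightarrow>
     (\<forall>A\<in>sets \<nu>. emeasure \<nu> A = \<infinity> \<or> (\<exists>k::nat. emeasure \<nu> A = of_nat k)) \<and>
     (\<forall>C. compactin T C \<longrightarrow> emeasure \<nu> C < \<infinity>)"

text \<open>\<open>\<xi>\<close> is a Poisson process on the topological space \<open>T\<close> with intensity measure \<open>\<mu>\<close>, defined
  on the probability space \<open>M\<close>.\<close>

definition poisson_process ::
    "'w measure \<Rightarrow> 'b topology \<Rightarrow> 'b measure \<Rightarrow> ('w \<Rightarrow> 'b measure) \<Rightarrow> bool" where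
  "poisson_process M T \<mu> \<xi> \<longleftrightarrow>
     prob_space M \<and>
     (\<forall>\<omega>\<in>space M. sets (\<xi> \<omega>) = sets \<mu> \<and> locally_finite_counting_measure T (\<xi> \<omega>)) \<and>
     (\<forall>A\<in>sets \<mu>. (\<lambda>\<omega>. emeasure (\<xi> \<omega>) A) \<in> borel_measurable M) \<and>
     (\<forall>A\<in>sets \<mu>. emeasure \<mu> A < \<infinity> \<longrightarrow>
        (\<forall>k::nat. measure M {\<omega> \<in> space M. emeasure (\<xi> \<omega>) A = of_nat k} =
                  exp (- measure \<mu> A) * measure \<mu> A ^ k / fact k)) \<and>
     (\<forall>(I :: nat set) A. finite I \<and> A ` I \<subseteq> sets \<mu> \<and> disjoint_family_on A I \<longrightarrow>
        prob_space.indep_vars M (\<lambda>_. borel) (\<lambda>i \<omega>. emeasure (\<xi> \<omega>) (A i)) I)"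

text \<open>For a measure \<open>\<nu>\<close> on the product of the time axis and the space of hyperplanes, this is the
  measure \<open>A \<mapsto> \<nu> ({0..r} \<times> A)\<close>.\<close>

definition time_section :: "real \<Rightarrow> (real \<times> 'a::euclidean_space set) measure \<Rightarrow> 'a set measure" where
  "time_section r \<nu> =
     distr (restrict_space \<nu> ({0..r} \<times> hyperplanes)) (borel_of hyperplane_topology) snd"

lemma emeasure_time_section:
  assumes \<nu>: "sets \<nu> = sets (restrict_space lborel {0..} \<Otimes>\<^sub>M hyperplane_measure \<phi> \<gamma>)"
    and A: "A \<in> sets (borel_of hyperplane_topology)" and "0 \<le> r"
  shows "emeasure (time_section r \<nu>) A = emeasure \<nu> ({0..r} \<times> A)"
proof -
  let ?B = "borel_of hyperplane_topology :: 'a set measure"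
  have sp: "space ?B = hyperplanes"
    by (simp add: borel_of_def topspace_hyperplane_topology space_measure_of_conv)
  have [measurable_cong]: "sets (hyperplane_measure \<phi> \<gamma>) = sets ?B"
    unfolding hyperplane_measure_def using sets.sigma_sets_eq[of ?B] sets.space_closed[of ?B]
    by (simp add: sp)
  have \<nu>': "sets \<nu> = sets (restrict_space lborel {0..} \<Otimes>\<^sub>M ?B)"
    unfolding \<nu> by (rule sets_pair_measure_cong) (use \<open>sets (hyperplane_measure \<phi> \<gamma>) = sets ?B\<close> in auto)
  have I: "{0..r} \<in> sets (restrict_space lborel {0::real..})"
    using \<open>0 \<le> r\<close> by (auto simp: sets_restrict_space_iff)
  have rect: "{0..r} \<times> C \<in> sets \<nu>" if "C \<in> sets ?B" for C
    unfolding \<nu>' using I that by auto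
  have H: "{0..r} \<times> hyperplanes \<in> sets \<nu>"
    using rect[OF sets.top] by (simp add: sp)
  have snd: "snd \<in> measurable \<nu> ?B"
    using measurable_cong_sets[OF \<nu>' refl] measurable_snd by blast
  have AH: "A \<subseteq> hyperplanes"
    using sets.sets_into_space[OF A] by (simp add: sp)
  have "emeasure (time_section r \<nu>) A =
      emeasure (restrict_space \<nu> ({0..r} \<times> hyperplanes))
        (snd -` A \<inter> space (restrict_space \<nu> ({0..r} \<times> hyperplanes)))"
    unfolding time_section_def by (intro emeasure_distr measurable_restrict_space1 snd A)
  also have "snd -` A \<inter> space (restrict_space \<nu> ({0..r} \<times> hyperplanes)) = {0..r} \<times> A"
    using sets.sets_into_space[OF H] AH by (auto simp: space_restrict_space)
  also have "emeasure (restrict_space \<nu> ({0..r} \<times> hyperplanes)) \<dots> = emeasure \<nu> ({0..r} \<times> A)"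
    using AH H sets.sets_into_space[OF H] by (intro emeasure_restrict_space) auto
  finally show ?thesis .
qed

text \<open>The locally finite set of hyperplanes obtained from the points with time coordinate in
  \<open>{0..r}\<close>.\<close>

definition hyperplane_process :: "real \<Rightarrow> (real \<times> 'a::euclidean_space set) measure \<Rightarrow> 'a set set" where
  "hyperplane_process r \<nu> = measure_support hyperplane_topology (time_section r \<nu>)"


section \<open>The K-cell\<close>

text \<open>The closed halfspace bounded by \<open>H\<close> that contains \<open>K\<close>; used for nonempty convex \<open>K\<close> disjoint
  from the hyperplane \<open>H\<close>, where it is unique.\<close>

definition halfspace_containing :: "'a::euclidean_space set \<Rightarrow> 'a set \<Rightarrow> 'a set" where
  "halfspace_containing K H =
     (THE S. \<exists>u t. norm u = 1 \<and> H = hyperplane u t \<and> S = {x. x \<bullet> u \<le> t} \<and> K \<subseteq> S)"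

lemma halfspace_containing_eq:
  assumes "K \<noteq> {}" "norm u = 1" "K \<subseteq> {x. x \<bullet> u \<le> t}" "hyperplane u t \<inter> K = {}"
  shows "halfspace_containing K (hyperplane u t) = {x. x \<bullet> u \<le> t}"
  unfolding halfspace_containing_def
proof (rule the_equality)
  fix S assume "\<exists>v s. norm v = 1 \<and> hyperplane u t = hyperplane v s \<and> S = {x. x \<bullet> v \<le> s} \<and> K \<subseteq> S"
  then obtain v s where v: "norm v = 1" and eq: "hyperplane u t = hyperplane v s"
    and S: "S = {x. x \<bullet> v \<le> s}" "K \<subseteq> S" by blast
  have uu: "u \<bullet> u = 1" and vv: "v \<bullet> v = 1"
    using assms(2) v by (simp_all add: dot_square_norm)
  have base: "(t *\<^sub>R u + (w - (w \<bullet> u) *\<^sub>R u)) \<bullet> v = s" for w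
  proof -
    have "t *\<^sub>R u + (w - (w \<bullet> u) *\<^sub>R u) \<in> hyperplane u t"
      by (simp add: hyperplane_def inner_add_left inner_diff_left uu)
    then show ?thesis unfolding eq by (simp add: hyperplane_def)
  qed
  have s: "s = t * (u \<bullet> v)" using base[of 0] by simp
  have lin: "w \<bullet> v = (w \<bullet> u) * (u \<bullet> v)" for w
    using base[of w] s by (simp add: inner_add_left inner_diff_left)
  define c where "c = u \<bullet> v"
  have "c * c = 1" using lin[of v] vv by (simp add: c_def inner_commute)
  then have c: "c = 1 \<or> c = -1" by (simp add: square_eq_1_iff)
  obtain k where k: "k \<in> K" using assms(1) by blast
  have "k \<bullet> u < t" using assms(3,4) k by (force simp: hyperplane_def)
  moreover have "k \<bullet> v \<le> s" using S k by blast
  ultimately have "c = 1" using c s lin[of k] by (auto simp flip: c_def)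
  then have "w \<bullet> v = w \<bullet> u" "s = t" for w
    using lin[of w] s unfolding c_def by (metis mult.right_neutral)+
  then show "S = {x. x \<bullet> u \<le> t}" using S by simp
qed (use assms in blast)

definition K_cell :: "'a::euclidean_space set \<Rightarrow> 'a set set \<Rightarrow> 'a set" where
  "K_cell K X = (\<Inter>H \<in> {H \<in> X. H \<inter> K = {}}. halfspace_containing K H)"


section \<open>Almost sure growth rates\<close>

definition almost_surely_bigo :: "'w measure \<Rightarrow> (nat \<Rightarrow> 'w \<Rightarrow> real) \<Rightarrow> (nat \<Rightarrow> real) \<Rightarrow> bool" where
  "almost_surely_bigo M Y f \<longleftrightarrow>
     (\<exists>C. AE \<omega> in M. \<forall>\<^sub>F n in sequentially. Y n \<omega> \<le> C * f n)"

end

theory Submission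
  imports Defs "HOL-Real_Asymp.Real_Asymp"
begin

text \<open>The number of hyperplanes of the process with time at most \<open>n\<close> that separate a point \<open>x\<close> from
  \<open>K\<close> is Poisson with mean at least \<open>n a \<phi>(U)\<close>, where \<open>U\<close> is the set of unit vectors \<open>u\<close> with
  \<open>h\<^sub>K(u) + a \<le> x \<bullet> u\<close>. If \<open>a \<phi>(U) \<ge> c \<eta>\<^sup>p\<close> for all \<open>x\<close> at small distance \<open>\<eta>\<close> from \<open>K\<close>, a union bound
  over a net of mesh \<open>1/n\<close> and the Borel-Cantelli lemma give the rate \<open>(ln n / n)\<^sup>1\<^sup>/\<^sup>p\<close>.

  For \<open>\<phi> \<ge> b \<sigma>\<close> one takes a cap of radius of order \<open>\<eta>\<close>, and \<open>p = d\<close>. For \<open>\<phi> \<ge> b S\<^sub>d\<^sub>-\<^sub>1(K, \<cdot>)\<close> one takes the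
  normals at the boundary points of \<open>K\<close> that are projected, from an interior point \<open>z\<close>, from a ball of
  radius \<open>\<rho>\<close> near \<open>x\<close>. The cone over this patch with apex \<open>z\<close> contains a tube of volume of order
  \<open>\<rho>\<^sup>d\<^sup>-\<^sup>1\<close>, which bounds its Hausdorff measure from below. In general \<open>\<rho>\<close> must be of order
  \<open>\<eta>\<close>, so that again \<open>p = d\<close>. If a ball slides freely inside \<open>K\<close>, normals vary in a Lipschitz way and \<open>\<rho>\<close> may be of
  order \<open>\<eta>\<^sup>1\<^sup>/\<^sup>2\<close>, so that \<open>p = 1 + (d - 1) / 2\<close>. If \<open>K\<close> is a polytope, the patch meets a facet of
  positive measure, whose normal is an atom of \<open>\<phi>\<close>, so that \<open>p = 1\<close>.\<close>

section \<open>Volumes of cones and Hausdorff measure\<close>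

text \<open>Volumes of these cones stand in for Hausdorff measures of boundary patches. With apex 0
  and \<open>Y\<close> on the unit sphere it is the cone in
  \<open>spherical_lebesgue\<close>.\<close>

definition cone_over :: "'a::real_vector \<Rightarrow> 'a set \<Rightarrow> 'a set" where
  "cone_over z Y = {z + s *\<^sub>R (y - z) | s y. 0 \<le> s \<and> s \<le> 1 \<and> y \<in> Y}"

lemma cone_over_image: "cone_over z Y = (\<lambda>(s, y). z + s *\<^sub>R (y - z)) ` ({0..1} \<times> Y)"
  unfolding cone_over_def by (force simp: image_iff)

lemma cone_over_mono: "X \<subseteq> Y \<Longrightarrow> cone_over z X \<subseteq> cone_over z Y"
  unfolding cone_over_def by blast

lemma cone_over_UN: "cone_over z (\<Union>i\<in>I. Y i) = (\<Union>i\<in>I. cone_over z (Y i))"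
  unfolding cone_over_def by blast

lemma compact_cone_over:
  fixes Y :: "'a::real_normed_vector set"
  assumes "compact Y"
  shows "compact (cone_over z Y)"
  unfolding cone_over_image
  by (intro compact_continuous_image compact_Times assms)
     (auto intro!: continuous_intros simp: case_prod_unfold)

text \<open>About D / \<delta> balls of radius 2 \<delta>, centred along the segment at spacing at
  most \<delta>, cover the neighbourhood, and each has volume of order \<delta> to the power d. The
  Borel superset \<open>V\<close> is their union, so the neighbourhood itself need not be shown
  measurable.\<close>

lemma segment_nbhd_volume_le:
  fixes a b :: "'a::euclidean_space"
  assumes "0 < \<delta>" "\<delta> \<le> 1" "dist a b \<le> D"
  shows "\<exists>V\<in>sets borel. {z. \<exists>w\<in>closed_segment a b. dist z w \<le> \<delta>} \<subseteq> V \<and>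
    emeasure lborel V \<le>
      ennreal ((D + 3) * unit_ball_vol (real DIM('a)) * 2 ^ DIM('a) * \<delta> ^ (DIM('a) - 1))"
proof -
  have D: "0 \<le> D" using assms(3) zero_le_dist order_trans by blast
  \<comment> \<open>The added 1 keeps \<open>N\<close> positive when \<open>D = 0\<close>.\<close>
  define N where "N = nat \<lceil>D / \<delta>\<rceil> + 1"
  have "0 \<le> D / \<delta>" using D assms(1) by simp
  then have N: "D / \<delta> \<le> real N" "real N \<le> D / \<delta> + 2" "N > 0"
    unfolding N_def by linarith+
  have DN: "D / real N \<le> \<delta>" using N assms(1) by (simp add: field_simps)
  define V where "V = (\<Union>j\<in>{..N}. cball (a + (real j / real N) *\<^sub>R (b - a)) (2 * \<delta>))"
  have sub: "{z. \<exists>w\<in>closed_segment a b. dist z w \<le> \<delta>} \<subseteq> V"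
  proof safe
    fix z w assume "w \<in> closed_segment a b" and zw: "dist z w \<le> \<delta>"
    then obtain s where s: "0 \<le> s" "s \<le> 1" "w = a + s *\<^sub>R (b - a)"
      unfolding in_segment by (auto simp: algebra_simps)
    define j where "j = nat \<lfloor>s * real N\<rfloor>"
    have "0 \<le> s * real N" using s by simp
    then have j: "real j \<le> s * real N" "s * real N \<le> real j + 1"
      unfolding j_def by linarith+
    have "real j \<le> real N" using j(1) s(2) N(3) mult_left_le_one_le[of "real N" s] s(1) by linarith
    then have jN: "j \<le> N" by simp
    have "s - real j / real N = (s * real N - real j) / real N"
      using N(3) by (simp add: diff_divide_distrib)
    then have "\<bar>s - real j / real N\<bar> \<le> 1 / real N"
      using j N(3) by (simp add: divide_right_mono)
    then have "\<bar>s - real j / real N\<bar> * dist a b \<le> (1 / real N) * D"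
      using assms(3) by (intro mult_mono) auto
    moreover have "dist w (a + (real j / real N) *\<^sub>R (b - a)) = \<bar>s - real j / real N\<bar> * dist a b"
      unfolding s(3) dist_norm by (simp add: norm_minus_commute flip: scaleR_diff_left)
    ultimately have "dist w (a + (real j / real N) *\<^sub>R (b - a)) \<le> \<delta>" using DN by simp
    then have "dist z (a + (real j / real N) *\<^sub>R (b - a)) \<le> 2 * \<delta>"
      using zw dist_triangle[of z "a + (real j / real N) *\<^sub>R (b - a)" w] by linarith
    then show "z \<in> V" unfolding V_def using jN by (auto simp: dist_commute)
  qed
  have d: "\<delta> ^ DIM('a) = \<delta> * \<delta> ^ (DIM('a) - 1)"
    by (simp add: power_eq_if)
  have "emeasure lborel V \<le> (\<Sum>j\<in>{..N}. emeasure lborel (cball (a + (real j / real N) *\<^sub>R (b - a)) (2 * \<delta>)))"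
    unfolding V_def by (rule emeasure_subadditive_finite) auto
  also have "\<dots> = ennreal ((real N + 1) * (unit_ball_vol (real DIM('a)) * (2 * \<delta>) ^ DIM('a)))"
    using assms(1) by (simp add: emeasure_cball flip: ennreal_of_nat_eq_real_of_nat ennreal_mult' ennreal_1 ennreal_plus)
      (simp add: ennreal_mult' ennreal_plus ennreal_of_nat_eq_real_of_nat[symmetric] add.commute)
  also have "\<dots> \<le> ennreal ((D + 3) * unit_ball_vol (real DIM('a)) * 2 ^ DIM('a) * \<delta> ^ (DIM('a) - 1))"
  proof (rule ennreal_leI)
    \<comment> \<open>Here the assumption that \<delta> is at most 1 turns D + 3 \<delta> into D +
      3.\<close>
    have "(real N + 1) * \<delta> \<le> (D / \<delta> + 3) * \<delta>" using N assms(1) by (intro mult_right_mono) auto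
    also have "\<dots> \<le> D + 3" using assms by (simp add: field_simps)
    finally have "(real N + 1) * \<delta> * (unit_ball_vol (real DIM('a)) * 2 ^ DIM('a) * \<delta> ^ (DIM('a) - 1))
        \<le> (D + 3) * (unit_ball_vol (real DIM('a)) * 2 ^ DIM('a) * \<delta> ^ (DIM('a) - 1))"
      using assms(1) by (intro mult_right_mono) auto
    then show "(real N + 1) * (unit_ball_vol (real DIM('a)) * (2 * \<delta>) ^ DIM('a))
        \<le> (D + 3) * unit_ball_vol (real DIM('a)) * 2 ^ DIM('a) * \<delta> ^ (DIM('a) - 1)"
      by (simp add: power_mult_distrib d mult_ac)
  qed
  finally show ?thesis using sub unfolding V_def by (intro bexI[of _ V]) (auto simp: V_def)
qed

text \<open>Treats covering sets of diameter 0, where the preceding estimate, which needs a positive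
  radius, is replaced by the fact that a segment has dimension at most 1 < d.\<close>

lemma emeasure_closed_segment_eq_0:
  fixes a b :: "'a::euclidean_space"
  assumes "2 \<le> DIM('a)"
  shows "emeasure lborel (closed_segment a b) = 0"
proof -
  have "dim (closed_segment 0 (b - a)) \<le> dim (span {b - a})"
    by (intro dim_subset) (auto simp: in_segment span_scale span_base)
  also have "\<dots> \<le> 1" by (simp add: dim_singleton)
  finally have "negligible ((+) a ` closed_segment 0 (b - a))"
    using assms by (intro negligible_translation negligible_lowdim) simp
  then have "negligible (closed_segment a b)"
    by (simp flip: closed_segment_translation)
  then show ?thesis
    by (simp add: negligible_iff_null_sets null_sets_def)
qed

text \<open>The cone over a set of diameter \<open>\<delta>\<close> lies in the \<open>\<delta>\<close>-neighbourhood of a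
  segment, which has volume of order \<open>\<delta> ^ (d - 1)\<close>.\<close>

lemma hausdorff_measure_ge_cone_volume:
  assumes "2 \<le> DIM('a::euclidean_space)"
  shows "\<exists>c>0. \<forall>(z :: 'a) Y T. Y \<subseteq> cball z D \<longrightarrow> T \<in> sets borel \<longrightarrow> T \<subseteq> cone_over z Y \<longrightarrow>
    ennreal c * emeasure lborel T \<le> hausdorff_measure (DIM('a) - 1) Y"
proof (cases "D \<ge> 0")
  case False
  then have "(cball z D :: 'a set) = {}" for z by simp
  then show ?thesis by (intro exI[of _ 1]) (auto simp: cone_over_def)
next
  case D: True
  define A where "A = (D + 3) * unit_ball_vol (real DIM('a)) * 2 ^ DIM('a)"
  define B where "B = unit_ball_vol (real (DIM('a) - 1)) / 2 ^ (DIM('a) - 1)"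
  have AB: "A > 0" "B > 0" using D unfolding A_def B_def
    by (auto intro!: mult_pos_pos divide_pos_pos unit_ball_vol_pos)
  \<comment> \<open>Ratio of the summand \<open>B * \<delta> ^ (d - 1)\<close> of the premeasure to
    the volume bound \<open>A * \<delta> ^ (d - 1)\<close> for the corresponding cone.\<close>
  define c where "c = B / A"
  have c: "c > 0" "c * A = B" using AB by (auto simp: c_def)
  have "ennreal c * emeasure lborel T \<le> hausdorff_measure (DIM('a) - 1) Y"
    if Y: "Y \<subseteq> cball z D" and T: "T \<in> sets borel" "T \<subseteq> cone_over z Y" for z :: 'a and Y T
  proof -
    \<comment> \<open>The Hausdorff measure is a supremum over mesh sizes, so one of them suffices.
      Mesh 1 gives the bound \<delta> <= 1 that the segment estimate needs.\<close>
    have "ennreal c * emeasure lborel T \<le> hausdorff_premeasure (DIM('a) - 1) 1 Y"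
      unfolding hausdorff_premeasure_def
    proof (rule INF_greatest, clarify)
      fix C :: "nat \<Rightarrow> 'a set"
      assume cov: "Y \<subseteq> (\<Union>i. C i)" and C: "\<forall>i. bounded (C i) \<and> diameter (C i) \<le> 1"
      let ?t = "\<lambda>i. if C i = {} then 0 else
        ennreal (unit_ball_vol (real (DIM('a) - 1)) * (diameter (C i) / 2) ^ (DIM('a) - 1))"
      \<comment> \<open>Intersecting with \<open>Y\<close> provides an axis point in
        \<open>cball z D\<close>, which bounds the length of the axis by \<open>D\<close>.\<close>
      have "\<exists>V\<in>sets borel. cone_over z (C i \<inter> Y) \<subseteq> V \<and> ennreal c * emeasure lborel V \<le> ?t i" for i
      proof (cases "C i \<inter> Y = {}")
        case True
        then show ?thesis by (intro bexI[of _ "{}"]) (auto simp: cone_over_def)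
      next
        case False
        then obtain y where y: "y \<in> C i" "y \<in> Y" by blast
        define \<delta> where "\<delta> = diameter (C i)"
        have \<delta>: "0 \<le> \<delta>" "\<delta> \<le> 1" using C by (auto simp: \<delta>_def diameter_ge_0)
        have t: "?t i = ennreal (B * \<delta> ^ (DIM('a) - 1))"
          using y by (auto simp: B_def \<delta>_def power_divide)
        have near: "\<exists>w\<in>closed_segment z y. dist x w \<le> \<delta>" if x: "x \<in> cone_over z (C i \<inter> Y)" for x
        proof -
          obtain s v where s: "0 \<le> s" "s \<le> 1" "v \<in> C i" "x = z + s *\<^sub>R (v - z)"
            using x unfolding cone_over_def by blast
          have "dist v y \<le> \<delta>" unfolding \<delta>_def using C s y diameter_bounded_bound by blast
          then have "s * dist v y \<le> 1 * \<delta>" using s \<delta> by (intro mult_mono) auto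
          moreover have "dist x (z + s *\<^sub>R (y - z)) = s * dist v y"
            using s by (simp add: dist_norm flip: scaleR_diff_right)
          moreover have "z + s *\<^sub>R (y - z) \<in> closed_segment z y"
            using s unfolding in_segment by (intro exI[of _ s]) (auto simp: algebra_simps)
          ultimately show ?thesis by (intro bexI) auto
        qed
        show ?thesis
        proof (cases "\<delta> = 0")
          case True
          then have "cone_over z (C i \<inter> Y) \<subseteq> closed_segment z y" using near by force
          then show ?thesis
            by (intro bexI[of _ "closed_segment z y"])
               (simp_all add: emeasure_closed_segment_eq_0[OF assms])
        next
          case False
          have "dist z y \<le> D" using y Y by auto
          then obtain V where V: "V \<in> sets borel" "{x. \<exists>w\<in>closed_segment z y. dist x w \<le> \<delta>} \<subseteq> V"
            "emeasure lborel V \<le> ennreal (A * \<delta> ^ (DIM('a) - 1))"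
            using segment_nbhd_volume_le[of \<delta> z y D] \<delta> False unfolding A_def by auto
          have "ennreal c * emeasure lborel V \<le> ennreal c * ennreal (A * \<delta> ^ (DIM('a) - 1))"
            by (intro mult_left_mono V) auto
          also have "\<dots> = ennreal (c * A * \<delta> ^ (DIM('a) - 1))" using c(1)
            by (simp add: mult.assoc flip: ennreal_mult')
          also have "\<dots> = ?t i" unfolding t c ..
          finally show ?thesis using V near by (intro bexI[of _ V]) auto
        qed
      qed
      then obtain V where V: "\<And>i. V i \<in> sets borel" "\<And>i. cone_over z (C i \<inter> Y) \<subseteq> V i"
        "\<And>i. ennreal c * emeasure lborel (V i) \<le> ?t i" by metis
      have "Y = (\<Union>i. C i \<inter> Y)" using cov by blast
      then have "cone_over z Y = (\<Union>i. cone_over z (C i \<inter> Y))" using cone_over_UN by metis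
      then have "T \<subseteq> (\<Union>i. V i)" using T V(2) by blast
      then have "emeasure lborel T \<le> emeasure lborel (\<Union>i. V i)"
        using V(1) by (intro emeasure_mono) auto
      also have "\<dots> \<le> (\<Sum>i. emeasure lborel (V i))"
        using V(1) by (intro emeasure_subadditive_countably) auto
      finally have "ennreal c * emeasure lborel T \<le> ennreal c * (\<Sum>i. emeasure lborel (V i))"
        by (intro mult_left_mono) auto
      also have "\<dots> = (\<Sum>i. ennreal c * emeasure lborel (V i))" by simp
      also have "\<dots> \<le> (\<Sum>i. ?t i)" by (intro suminf_le V) auto
      finally show "ennreal c * emeasure lborel T \<le> (\<Sum>i. ?t i)" .
    qed
    also have "\<dots> \<le> hausdorff_measure (DIM('a) - 1) Y"
      unfolding hausdorff_measure_def by (rule SUP_upper) auto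
    finally show ?thesis .
  qed
  then show ?thesis using c by blast
qed

text \<open>At least l / (4 \<rho>) disjoint balls of radius \<open>s\<^sub>0 * \<rho> / 2\<close>
  fit along the axis: at scaling \<sigma> the cone has radius \<sigma> \<rho>, and only scalings
  between \<open>s\<^sub>0 / 2\<close> and \<open>s\<^sub>0\<close> are used. Each ball has volume
  of order \<rho> to the power d, which leaves the power d - 1 in total.\<close>

lemma cone_over_ball_volume_ge:
  assumes "0 < l" "0 < s\<^sub>0"
  shows "\<exists>c>0. \<forall>(z :: 'a::euclidean_space) q\<^sub>0 \<rho>. l \<le> dist z q\<^sub>0 \<longrightarrow> 0 < \<rho> \<longrightarrow>
    (\<exists>T. open T \<and> T \<subseteq> {z + s *\<^sub>R (q - z) | s q. 0 \<le> s \<and> s \<le> s\<^sub>0 \<and> q \<in> ball q\<^sub>0 \<rho>} \<and>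
      ennreal (c * \<rho> ^ (DIM('a) - 1)) \<le> emeasure lborel T)"
proof -
  define c where "c = l / 4 * (unit_ball_vol (real DIM('a)) * (s\<^sub>0 / 2) ^ DIM('a))"
  have c: "c > 0" unfolding c_def using assms by (intro mult_pos_pos unit_ball_vol_pos) auto
  have "\<exists>T. open T \<and> T \<subseteq> {z + s *\<^sub>R (q - z) | s q. 0 \<le> s \<and> s \<le> s\<^sub>0 \<and> q \<in> ball q\<^sub>0 \<rho>} \<and>
      ennreal (c * \<rho> ^ (DIM('a) - 1)) \<le> emeasure lborel T"
    if l: "l \<le> dist z q\<^sub>0" and \<rho>: "0 < \<rho>" for z q\<^sub>0 :: 'a and \<rho>
  proof -
    define L where "L = dist z q\<^sub>0"
    have L: "L > 0" "l \<le> L" using l assms by (auto simp: L_def)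
    define v where "v = q\<^sub>0 - z"
    have v: "norm v = L" by (simp add: v_def L_def dist_norm norm_minus_commute)
    \<comment> \<open>Rounding down and adding 1 gives at least L / (4 \<rho>) balls, while every
      index j < N still satisfies j <= L / (4 \<rho>).\<close>
    define N where "N = nat \<lfloor>L / (4 * \<rho>)\<rfloor> + 1"
    have "0 \<le> L / (4 * \<rho>)" using L \<rho> by simp
    then have N: "L / (4 * \<rho>) \<le> real N" "real N \<le> L / (4 * \<rho>) + 1"
      unfolding N_def by linarith+
    define \<sigma> where "\<sigma> j = s\<^sub>0 * (1 - 2 * real j * \<rho> / L)" for j
    define F where "F j = ball (z + \<sigma> j *\<^sub>R v) (s\<^sub>0 * \<rho> / 2)" for j
    have \<sigma>: "s\<^sub>0 / 2 \<le> \<sigma> j" "\<sigma> j \<le> s\<^sub>0" if "j < N" for j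
    proof -
      have "real j + 1 \<le> real N" using that by linarith
      then have "real j \<le> L / (4 * \<rho>)" using N by linarith
      then have "2 * real j * \<rho> / L \<le> 1 / 2" using L \<rho> by (simp add: field_simps)
      then have "s\<^sub>0 * (1 / 2) \<le> \<sigma> j" unfolding \<sigma>_def using assms by (intro mult_left_mono) auto
      then show "s\<^sub>0 / 2 \<le> \<sigma> j" by simp
      have "0 \<le> 2 * real j * \<rho> / L" using L \<rho> by simp
      then have "\<sigma> j \<le> s\<^sub>0 * 1" unfolding \<sigma>_def using assms by (intro mult_left_mono) auto
      then show "\<sigma> j \<le> s\<^sub>0" by simp
    qed
    have sub: "F j \<subseteq> {z + s *\<^sub>R (q - z) | s q. 0 \<le> s \<and> s \<le> s\<^sub>0 \<and> q \<in> ball q\<^sub>0 \<rho>}" if "j < N" for j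
    proof
      fix w assume "w \<in> F j"
      then have w: "norm (w - (z + \<sigma> j *\<^sub>R v)) < s\<^sub>0 * \<rho> / 2"
        by (simp add: F_def dist_norm norm_minus_commute)
      have pos: "\<sigma> j > 0" using \<sigma>[OF that] assms by linarith
      define q where "q = z + (1 / \<sigma> j) *\<^sub>R (w - z)"
      have "w = z + \<sigma> j *\<^sub>R (q - z)" using pos by (simp add: q_def)
      moreover have "q - q\<^sub>0 = (1 / \<sigma> j) *\<^sub>R (w - (z + \<sigma> j *\<^sub>R v))"
        using pos by (simp add: q_def v_def scaleR_diff_right scaleR_add_right)
      then have "norm (q - q\<^sub>0) = norm (w - (z + \<sigma> j *\<^sub>R v)) / \<sigma> j" using pos by simp
      moreover have "s\<^sub>0 * \<rho> / 2 \<le> \<sigma> j * \<rho>" using \<sigma>[OF that] \<rho> by (simp add: mult_right_mono)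
      then have "norm (w - (z + \<sigma> j *\<^sub>R v)) / \<sigma> j < \<rho>" using w pos by (simp add: field_simps)
      ultimately show "w \<in> {z + s *\<^sub>R (q - z) | s q. 0 \<le> s \<and> s \<le> s\<^sub>0 \<and> q \<in> ball q\<^sub>0 \<rho>}"
        using pos \<sigma>[OF that]
        by (intro CollectI exI[of _ "\<sigma> j"] exI[of _ q]) (auto simp: dist_norm norm_minus_commute)
    qed
    have disj: "disjoint_family_on F {..<N}"
      unfolding disjoint_family_on_def
    proof (intro ballI impI)
      fix i j assume "i \<in> {..<N}" "j \<in> {..<N}" "i \<noteq> j"
      have "\<bar>real j - real i\<bar> \<ge> 1" using \<open>i \<noteq> j\<close> by linarith
      then have "2 * s\<^sub>0 * \<rho> * \<bar>real j - real i\<bar> \<ge> 2 * s\<^sub>0 * \<rho> * 1"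
        using assms \<rho> by (intro mult_left_mono) auto
      moreover have "dist (z + \<sigma> i *\<^sub>R v) (z + \<sigma> j *\<^sub>R v) = \<bar>\<sigma> i - \<sigma> j\<bar> * L"
        by (simp add: dist_norm v flip: scaleR_diff_left)
      moreover have "\<sigma> i - \<sigma> j = 2 * s\<^sub>0 * \<rho> * (real j - real i) / L"
        using L by (simp add: \<sigma>_def field_simps)
      then have "\<bar>\<sigma> i - \<sigma> j\<bar> * L = 2 * s\<^sub>0 * \<rho> * \<bar>real j - real i\<bar>"
        using L \<rho> assms by (simp add: abs_mult)
      ultimately have "dist (z + \<sigma> i *\<^sub>R v) (z + \<sigma> j *\<^sub>R v) \<ge> 2 * s\<^sub>0 * \<rho>" by simp
      moreover have "s\<^sub>0 * \<rho> > 0" using assms \<rho> by simp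
      ultimately show "F i \<inter> F j = {}"
        unfolding F_def by (intro disjoint_ballI) linarith
    qed
    define T where "T = (\<Union>j\<in>{..<N}. F j)"
    have "emeasure lborel T = (\<Sum>j\<in>{..<N}. emeasure lborel (F j))"
      unfolding T_def by (rule sum_emeasure[symmetric, OF _ disj]) (auto simp: F_def)
    also have "\<dots> = ennreal (real N * (unit_ball_vol (real DIM('a)) * (s\<^sub>0 * \<rho> / 2) ^ DIM('a)))"
      using assms \<rho> by (simp add: F_def emeasure_ball ennreal_mult' ennreal_of_nat_eq_real_of_nat)
    also have "\<dots> \<ge> ennreal (c * \<rho> ^ (DIM('a) - 1))"
    proof (rule ennreal_leI)
      have "l / (4 * \<rho>) \<le> L / (4 * \<rho>)" using L \<rho> by (simp add: divide_right_mono)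
      then have "l / (4 * \<rho>) \<le> real N" using N by linarith
      then have "l / (4 * \<rho>) * (unit_ball_vol (real DIM('a)) * (s\<^sub>0 * \<rho> / 2) ^ DIM('a))
          \<le> real N * (unit_ball_vol (real DIM('a)) * (s\<^sub>0 * \<rho> / 2) ^ DIM('a))"
        using assms \<rho> by (intro mult_right_mono) auto
      moreover have "\<rho> ^ DIM('a) = \<rho> * \<rho> ^ (DIM('a) - 1)" by (simp add: power_eq_if)
      then have "l / (4 * \<rho>) * (unit_ball_vol (real DIM('a)) * (s\<^sub>0 * \<rho> / 2) ^ DIM('a))
          = c * \<rho> ^ (DIM('a) - 1)"
        using \<rho> by (simp add: c_def power_mult_distrib power_divide)
      ultimately show "c * \<rho> ^ (DIM('a) - 1)
          \<le> real N * (unit_ball_vol (real DIM('a)) * (s\<^sub>0 * \<rho> / 2) ^ DIM('a))" by simp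
    qed
    finally show ?thesis
      using sub by (intro exI[of _ T]) (auto simp: T_def F_def intro!: open_UN)
  qed
  then show ?thesis using c by blast
qed

section \<open>The measure of separating hyperplanes\<close>

lemma hyperplane_eq_cases:
  assumes "norm u = 1" "norm v = 1" "hyperplane u t = hyperplane v s"
  shows "v = u \<and> s = t \<or> v = - u \<and> s = - t"
proof -
  have uu: "u \<bullet> u = 1" and vv: "v \<bullet> v = 1" using assms by (simp_all add: dot_square_norm)
  \<comment> \<open>As \<open>w\<close> varies, these points run through the whole first hyperplane.
    Hence inner products with \<open>v\<close> depend only on those with \<open>u\<close>, and
    \<open>v\<close> is a multiple of \<open>u\<close>.\<close>
  have base: "(t *\<^sub>R u + (w - (w \<bullet> u) *\<^sub>R u)) \<bullet> v = s" for w
  proof -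
    have "t *\<^sub>R u + (w - (w \<bullet> u) *\<^sub>R u) \<in> hyperplane u t"
      by (simp add: hyperplane_def inner_add_left inner_diff_left uu)
    then show ?thesis unfolding assms(3) by (simp add: hyperplane_def)
  qed
  define c where "c = u \<bullet> v"
  have s: "s = t * c" using base[of 0] by (simp add: c_def)
  have lin: "w \<bullet> v = (w \<bullet> u) * c" for w
    using base[of w] s by (simp add: inner_add_left inner_diff_left c_def)
  have "c * c = 1" using lin[of v] vv by (simp add: c_def inner_commute)
  then have "c = 1 \<or> c = -1" by (simp add: square_eq_1_iff)
  moreover have "v = c *\<^sub>R u"
    using lin vector_eq_ldot[of v "c *\<^sub>R u"] by (simp add: mult.commute)
  ultimately show ?thesis using s by auto
qed

lemma hyperplane_minus: "hyperplane (- u) (- t) = hyperplane u t"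
  by (auto simp: hyperplane_def)

abbreviation hyperplane_borel :: "'a::euclidean_space set measure" where
  "hyperplane_borel \<equiv> borel_of hyperplane_topology"

lemma space_hyperplane_borel: "space hyperplane_borel = (hyperplanes :: 'a::euclidean_space set set)"
  by (simp add: borel_of_def topspace_hyperplane_topology space_measure_of_conv)

lemma openin_imp_sets_hyperplane_borel:
  assumes "openin hyperplane_topology (U :: 'a::euclidean_space set set)"
  shows "U \<in> sets hyperplane_borel"
proof -
  have "{U :: 'a set set. openin hyperplane_topology U} \<subseteq> Pow (topspace hyperplane_topology)"
    using openin_subset by blast
  then show ?thesis using assms unfolding borel_of_def by simp
qed

text \<open>The topology is a quotient topology, so it must be checked that the preimage of the
  image is open; by the sign ambiguity this preimage is \<open>W\<close> together with its
  reflection.\<close>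

lemma openin_hyperplane_image:
  fixes W :: "('a::euclidean_space \<times> real) set"
  assumes "open W"
  shows "openin hyperplane_topology {hyperplane u t | u t. norm u = 1 \<and> (u, t) \<in> W}"
proof -
  let ?m = "\<lambda>p :: 'a \<times> real. (- fst p, - snd p)"
  have "open (?m -` W)" using assms by (intro open_vimage continuous_intros)
  then have "open (W \<union> ?m -` W)" using assms by blast
  moreover have "{(u, t). norm u = 1 \<and> hyperplane u t \<in> {hyperplane u t | u t. norm u = 1 \<and> (u, t) \<in> W}}
      = (unit_sphere \<times> UNIV) \<inter> (W \<union> ?m -` W)" (is "?L = ?R")
  proof
    show "?L \<subseteq> ?R"
    proof clarify
      fix a b u t assume a: "norm a = 1" "hyperplane a b = hyperplane u t" "norm u = 1" "(u, t) \<in> W"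
      from hyperplane_eq_cases[OF a(1,3,2)] a show "(a, b) \<in> ?R" by auto
    qed
    show "?R \<subseteq> ?L"
    proof
      fix p assume p: "p \<in> ?R"
      obtain a b where ab: "p = (a, b)" by fastforce
      have "norm a = 1" using p ab by simp
      have a: "(a, b) \<in> W \<or> (- a, - b) \<in> W" using p ab by simp
      have "\<exists>u t. hyperplane a b = hyperplane u t \<and> norm u = 1 \<and> (u, t) \<in> W"
        using a
      proof
        assume "(a, b) \<in> W"
        then show ?thesis using \<open>norm a = 1\<close> by blast
      next
        assume "(- a, - b) \<in> W"
        then show ?thesis using \<open>norm a = 1\<close> hyperplane_minus[of a b, symmetric]
          by (metis norm_minus_cancel)
      qed
      then show "p \<in> ?L" using \<open>norm a = 1\<close> unfolding ab by blast
    qed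
  qed
  ultimately show ?thesis
    unfolding openin_hyperplane_topology by (auto simp: hyperplanes_def openin_open)
qed

text \<open>Both inequalities are strict so that, for compact \<open>K\<close>, the set is open: it
  is then measurable and can be compared with the support of the process.\<close>

definition separating_hyperplanes :: "'a::euclidean_space set \<Rightarrow> 'a \<Rightarrow> 'a set set" where
  "separating_hyperplanes K x =
     {hyperplane u t | u t. norm u = 1 \<and> (\<forall>k\<in>K. k \<bullet> u < t) \<and> t < x \<bullet> u}"

text \<open>The pairs (u, t) with t <= k . u for some k in K form the projection of a closed set
  along the compact set \<open>K\<close>, which is closed.\<close>

lemma openin_separating_hyperplanes:
  assumes "compact K"
  shows "openin hyperplane_topology (separating_hyperplanes K x)"
proof -
  have "closed {(k, u :: 'a, t :: real). t \<le> k \<bullet> u}"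
    unfolding case_prod_unfold by (intro closed_Collect_le continuous_intros)
  from closed_compact_projection[OF assms this]
  have "open (- {(u, t). \<exists>k\<in>K. t \<le> k \<bullet> u})"
    by (simp add: closed_def[symmetric] open_closed case_prod_unfold Bex_def)
  moreover have "open {(u :: 'a, t :: real). t < x \<bullet> u}"
    unfolding case_prod_unfold by (intro open_Collect_less continuous_intros)
  ultimately have "open (- {(u, t). \<exists>k\<in>K. t \<le> k \<bullet> u} \<inter> {(u, t). t < x \<bullet> u})" by blast
  from openin_hyperplane_image[OF this]
  have "openin hyperplane_topology {hyperplane u t |u t. norm u = 1 \<and>
    (u, t) \<in> - {(u, t). \<exists>k\<in>K. t \<le> k \<bullet> u} \<inter> {(u, t). t < x \<bullet> u}}" .
  moreover have "separating_hyperplanes K x = {hyperplane u t |u t. norm u = 1 \<and>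
    (u, t) \<in> - {(u, t). \<exists>k\<in>K. t \<le> k \<bullet> u} \<inter> {(u, t). t < x \<bullet> u}}"
    by (auto simp: separating_hyperplanes_def not_le)
  ultimately show ?thesis by simp
qed

text \<open>For growing \<open>R\<close> these open sets exhaust the space of hyperplanes, and each
  has finite intensity.\<close>

definition hyperplanes_near_0 :: "real \<Rightarrow> 'a::euclidean_space set set" where
  "hyperplanes_near_0 R = {hyperplane u t | u t. norm u = 1 \<and> \<bar>t\<bar> < R}"

lemma openin_hyperplanes_near_0: "openin hyperplane_topology (hyperplanes_near_0 R)"
proof -
  have "open {p :: 'a \<times> real. \<bar>snd p\<bar> < R}" by (intro open_Collect_less continuous_intros)
  from openin_hyperplane_image[OF this] show ?thesis by (simp add: hyperplanes_near_0_def)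
qed

text \<open>It suffices to test open sets, whose preimages are relatively open by the choice of
  topology; open sets of the product space lie in the product sigma-algebra.\<close>

lemma measurable_hyperplane:
  "(\<lambda>(u :: 'a::euclidean_space, t). hyperplane u t) \<in> measurable (sphere_borel \<Otimes>\<^sub>M lborel) hyperplane_borel"
  unfolding borel_of_def
proof (rule measurable_measure_of)
  show "{U :: 'a set set. openin hyperplane_topology U} \<subseteq> Pow (topspace hyperplane_topology)"
    using openin_subset by blast
  show "(\<lambda>(u :: 'a, t). hyperplane u t) \<in> space (sphere_borel \<Otimes>\<^sub>M lborel) \<rightarrow> topspace hyperplane_topology"
    by (auto simp: space_pair_measure space_restrict_space topspace_hyperplane_topology hyperplanes_def)
  fix U :: "'a set set" assume "U \<in> {U. openin hyperplane_topology U}"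
  then obtain Q where Q: "open Q"
    "{(u, t). norm u = 1 \<and> hyperplane u t \<in> U} = (unit_sphere \<times> UNIV) \<inter> Q"
    by (auto simp: openin_hyperplane_topology openin_open)
  have "(\<lambda>p. fst p) \<in> measurable (sphere_borel \<Otimes>\<^sub>M lborel) (borel :: 'a measure)"
    by (rule measurable_compose[OF measurable_fst measurable_restrict_space1[OF measurable_id]])
  moreover have "snd \<in> measurable (sphere_borel \<Otimes>\<^sub>M lborel) (borel :: real measure)"
    using measurable_snd[of "sphere_borel" lborel] by simp
  ultimately have m: "(\<lambda>p. (fst p, snd p))
      \<in> measurable (sphere_borel \<Otimes>\<^sub>M lborel) (borel :: ('a \<times> real) measure)"
    unfolding borel_prod[symmetric] by (rule measurable_Pair)
  have "(\<lambda>p. (fst p, snd p)) -` Q \<inter> space (sphere_borel \<Otimes>\<^sub>M lborel) \<in> sets (sphere_borel \<Otimes>\<^sub>M lborel :: ('a \<times> real) measure)"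
    using measurable_sets[OF m borel_open[OF Q(1)]] by simp
  also have "(\<lambda>p. (fst p, snd p)) -` Q \<inter> space (sphere_borel \<Otimes>\<^sub>M lborel)
      = (\<lambda>(u, t). hyperplane u t) -` U \<inter> space (sphere_borel \<Otimes>\<^sub>M lborel :: ('a \<times> real) measure)"
    using Q(2) by (auto simp: space_pair_measure space_restrict_space set_eq_iff)
  finally show "(\<lambda>(u, t). hyperplane u t) -` U \<inter> space (sphere_borel \<Otimes>\<^sub>M lborel :: ('a \<times> real) measure)
    \<in> sets (sphere_borel \<Otimes>\<^sub>M lborel :: ('a \<times> real) measure)" .
qed

lemma sets_hyperplane_measure:
  fixes \<phi> :: "'a::euclidean_space measure"
  shows "sets (hyperplane_measure \<phi> \<gamma>) = sets hyperplane_borel"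
  unfolding hyperplane_measure_def
  using sets.sigma_sets_eq[of "hyperplane_borel :: 'a set measure"] sets.space_closed[of "hyperplane_borel :: 'a set measure"]
  by (simp add: space_hyperplane_borel)

section \<open>The intensity measure and its values on separating hyperplanes\<close>

definition line_measure :: "'a::euclidean_space set set \<Rightarrow> 'a \<Rightarrow> ennreal" where
  "line_measure A u = (\<integral>\<^sup>+t\<in>{0..}. indicator A (hyperplane u t) \<partial>lborel)"

context
  fixes \<phi> :: "'a::euclidean_space measure"
  assumes \<phi>: "prob_space \<phi>" "sets \<phi> = sets sphere_borel" "even_measure \<phi>"
begin

lemma space_\<phi>: "space \<phi> = unit_sphere"
  using sets_eq_imp_space_eq[OF \<phi>(2)] by (simp add: space_restrict_space)

lemma measurable_hyperplane_\<phi> [measurable]: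
  "(\<lambda>(u, t). hyperplane u t) \<in> measurable (\<phi> \<Otimes>\<^sub>M lborel) hyperplane_borel"
  using measurable_hyperplane measurable_cong_sets[OF sets_pair_measure_cong[OF \<phi>(2) refl] refl] by blast

lemma measurable_line_measure:
  assumes [measurable]: "A \<in> sets hyperplane_borel"
  shows "line_measure A \<in> borel_measurable \<phi>"
proof -
  have "(\<lambda>p. indicator A (case p of (u, t) \<Rightarrow> hyperplane u t) * indicator {0..} (snd p) :: ennreal)
      \<in> borel_measurable (\<phi> \<Otimes>\<^sub>M lborel)" by measurable
  from lborel.borel_measurable_nn_integral_fst[OF this] show ?thesis
    by (simp add: line_measure_def[abs_def])
qed

text \<open>\<open>measure_of\<close> takes the prescribed values only if these are countably
  additive. This follows by recognising them as the values of \<open>N\<close>, a scaled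
  push-forward of the product of \<phi> and Lebesgue measure on nonnegative offsets.\<close>

lemma emeasure_hyperplane_measure:
  assumes "A \<in> sets hyperplane_borel"
  shows "emeasure (hyperplane_measure \<phi> \<gamma>) A = ennreal (2 * \<gamma>) * (\<integral>\<^sup>+u. line_measure A u \<partial>\<phi>)"
proof -
  define N where "N = scale_measure (ennreal (2 * \<gamma>)) (distr (density (\<phi> \<Otimes>\<^sub>M lborel) (\<lambda>p. indicator {0..} (snd p)))
    hyperplane_borel (\<lambda>(u, t). hyperplane u t))"
  have N: "ennreal (2 * \<gamma>) * (\<integral>\<^sup>+u. (\<integral>\<^sup>+t\<in>{0..}. indicator A (hyperplane u t) \<partial>lborel) \<partial>\<phi>) = emeasure N A"
    if A [measurable]: "A \<in> sets hyperplane_borel" for A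
  proof -
    let ?D = "density (\<phi> \<Otimes>\<^sub>M lborel) (\<lambda>p. indicator {0..} (snd p) :: ennreal)"
    let ?h = "\<lambda>(u, t). hyperplane u t"
    have "emeasure (distr ?D hyperplane_borel ?h) A = emeasure ?D (?h -` A \<inter> space ?D)"
      by (rule emeasure_distr) auto
    also have "\<dots> = (\<integral>\<^sup>+p. indicator {0..} (snd p) * indicator (?h -` A \<inter> space ?D) p \<partial>(\<phi> \<Otimes>\<^sub>M lborel))"
    proof (rule emeasure_density)
      show "(\<lambda>p. indicator {0::real..} (snd p) :: ennreal) \<in> borel_measurable (\<phi> \<Otimes>\<^sub>M lborel)" by measurable
      show "?h -` A \<inter> space ?D \<in> sets (\<phi> \<Otimes>\<^sub>M lborel)"
        unfolding space_density by (rule measurable_sets[OF measurable_hyperplane_\<phi> A])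
    qed
    also have "\<dots> = (\<integral>\<^sup>+p. indicator A (?h p) * indicator {0..} (snd p) \<partial>(\<phi> \<Otimes>\<^sub>M lborel))"
      by (intro nn_integral_cong) (auto simp: indicator_def)
    also have "\<dots> = (\<integral>\<^sup>+u. (\<integral>\<^sup>+t. indicator A (?h (u, t)) * indicator {0..} (snd (u, t)) \<partial>lborel) \<partial>\<phi>)"
      by (rule lborel.nn_integral_fst[symmetric]) measurable
    finally show ?thesis by (simp add: N_def)
  qed
  have setsN: "sets N = sets hyperplane_borel" by (simp add: N_def)
  show ?thesis
  proof (subst emeasure_measure_of[OF hyperplane_measure_def])
    show "sets hyperplane_borel \<subseteq> Pow (hyperplanes :: 'a set set)"
      using sets.space_closed[of "hyperplane_borel :: 'a set measure"] by (simp add: space_hyperplane_borel)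
    show "A \<in> sets (hyperplane_measure \<phi> \<gamma>)" using assms by (simp add: sets_hyperplane_measure)
    show "positive (sets (hyperplane_measure \<phi> \<gamma>)) (\<lambda>A. ennreal (2 * \<gamma>) *
          (\<integral>\<^sup>+u. (\<integral>\<^sup>+t\<in>{0..}. indicator A (hyperplane u t) \<partial>lborel) \<partial>\<phi>))"
      by (simp add: positive_def)
    show "countably_additive (sets (hyperplane_measure \<phi> \<gamma>)) (\<lambda>A. ennreal (2 * \<gamma>) *
          (\<integral>\<^sup>+u. (\<integral>\<^sup>+t\<in>{0..}. indicator A (hyperplane u t) \<partial>lborel) \<partial>\<phi>))"
      unfolding countably_additive_def sets_hyperplane_measure
    proof (intro allI impI)
      fix B :: "nat \<Rightarrow> 'a set set"
      assume B: "range B \<subseteq> sets hyperplane_borel" "disjoint_family B" "(\<Union>i. B i) \<in> sets hyperplane_borel"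
      have "(\<Sum>i. emeasure N (B i)) = emeasure N (\<Union>i. B i)"
        using B by (intro suminf_emeasure) (auto simp: setsN)
      then show "(\<Sum>i. ennreal (2 * \<gamma>) * (\<integral>\<^sup>+u. (\<integral>\<^sup>+t\<in>{0..}. indicator (B i) (hyperplane u t) \<partial>lborel) \<partial>\<phi>))
        = ennreal (2 * \<gamma>) * (\<integral>\<^sup>+u. (\<integral>\<^sup>+t\<in>{0..}. indicator (\<Union>i. B i) (hyperplane u t) \<partial>lborel) \<partial>\<phi>)"
        using B N by (simp only: N[OF B(3)] N[OF subsetD[OF B(1) rangeI]])
    qed
  qed (simp add: line_measure_def[abs_def])
qed

lemma measurable_uminus_\<phi>: "uminus \<in> measurable \<phi> \<phi>"
proof -
  have "uminus \<in> measurable sphere_borel (sphere_borel :: 'a measure)"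
    by (intro measurable_restrict_space2 measurable_restrict_space1) (auto simp: space_restrict_space)
  then show ?thesis using measurable_cong_sets[OF \<phi>(2) \<phi>(2)] by blast
qed

lemma nn_integral_even:
  assumes "f \<in> borel_measurable \<phi>"
  shows "(\<integral>\<^sup>+u. f (- u) \<partial>\<phi>) = (\<integral>\<^sup>+u. f u \<partial>\<phi>)"
proof -
  have "distr \<phi> \<phi> uminus = \<phi>"
  proof (rule measure_eqI)
    fix A assume "A \<in> sets (distr \<phi> \<phi> uminus)"
    then have A: "A \<in> sets \<phi>" by simp
    have "A \<subseteq> unit_sphere" using sets.sets_into_space[OF A] space_\<phi> by simp
    then have "uminus -` A \<inter> space \<phi> = uminus ` A"
      unfolding space_\<phi> by (auto simp: image_iff) (metis minus_minus)
    then show "emeasure (distr \<phi> \<phi> uminus) A = emeasure \<phi> A"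
      using A measurable_uminus_\<phi> \<phi>(3) by (simp add: emeasure_distr even_measure_def)
  qed simp
  then show ?thesis using nn_integral_distr[OF measurable_uminus_\<phi>, of f] assms by simp
qed

text \<open>Offsets strictly between m, the maximum of k . u over K, and X = x . u yield separating
  hyperplanes, and X - m is at least \<open>a\<close>. Since \<open>line_measure\<close> sees
  nonnegative offsets only, the negative part of this interval is counted in direction -u.\<close>

lemma line_measure_separating_ge:
  assumes K: "compact K" "K \<noteq> {}" and u: "norm u = 1" and a: "\<forall>k\<in>K. a \<le> (x - k) \<bullet> u"
  shows "ennreal a \<le> line_measure (separating_hyperplanes K x) u
    + line_measure (separating_hyperplanes K x) (- u)"
proof -
  have "\<exists>k\<in>K. \<forall>y\<in>K. y \<bullet> u \<le> k \<bullet> u"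
    using K by (intro continuous_attains_sup continuous_intros)
  then obtain k where k: "k \<in> K" "\<And>y. y \<in> K \<Longrightarrow> y \<bullet> u \<le> k \<bullet> u" by blast
  define m where "m = k \<bullet> u"
  define X where "X = x \<bullet> u"
  have aX: "a \<le> X - m" using a k(1) by (auto simp: X_def m_def inner_diff_left)
  let ?A = "separating_hyperplanes K x"
  have in_A: "hyperplane u t \<in> ?A" if "m < t" "t < X" for t
  proof -
    have "\<forall>y\<in>K. y \<bullet> u < t" using k(2) that by (force simp: m_def)
    then show ?thesis unfolding separating_hyperplanes_def using u that by (auto simp: X_def)
  qed
  \<comment> \<open>If the interval is empty, \<open>ennreal\<close> truncates the negative
    difference to 0.\<close>
  have "ennreal (X - max m 0) = emeasure lborel {max m 0<..<X}"
    by (cases "max m 0 \<le> X") (auto simp: ennreal_neg)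
  also have "\<dots> = (\<integral>\<^sup>+t. indicator {max m 0<..<X} t \<partial>lborel)" by simp
  also have "\<dots> \<le> line_measure ?A u"
    unfolding line_measure_def using in_A by (intro nn_integral_mono) (auto simp: indicator_def)
  finally have 1: "ennreal (X - max m 0) \<le> line_measure ?A u" .
  have "ennreal (- m - max (- X) 0) = emeasure lborel {max (- X) 0<..<- m}"
    by (cases "max (- X) 0 \<le> - m") (auto simp: ennreal_neg)
  also have "\<dots> = (\<integral>\<^sup>+t. indicator {max (- X) 0<..<- m} t \<partial>lborel)" by simp
  also have "\<dots> \<le> line_measure ?A (- u)"
    unfolding line_measure_def
  proof (intro nn_integral_mono)
    fix t :: real
    have "hyperplane (- u) t \<in> ?A" if "max (- X) 0 < t" "t < - m"
      using in_A[of "- t"] that hyperplane_minus[of u "- t"] by simp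
    then show "indicator {max (- X) 0<..<- m} t \<le> (indicator ?A (hyperplane (- u) t) * indicator {0..} t :: ennreal)"
      by (auto simp: indicator_def)
  qed
  finally have 2: "ennreal (- m - max (- X) 0) \<le> line_measure ?A (- u)" .
  have "ennreal a \<le> ennreal (max 0 (X - max m 0) + max 0 (- m - max (- X) 0))"
    using aX by (intro ennreal_leI) linarith
  also have "\<dots> = ennreal (X - max m 0) + ennreal (- m - max (- X) 0)"
    by (simp add: ennreal_plus ennreal_max_0)
  also have "\<dots> \<le> line_measure ?A u + line_measure ?A (- u)"
    using 1 2 by (rule add_mono)
  finally show ?thesis .
qed

text \<open>By evenness of \<phi>, the two integrals over u and -u coincide, and together they
  produce exactly the factor 2 in the intensity measure.\<close>

lemma hyperplane_measure_separating_ge: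
  assumes K: "compact K" "K \<noteq> {}"
    and U: "U \<in> sets \<phi>" "\<And>u. u \<in> U \<Longrightarrow> \<forall>k\<in>K. a \<le> (x - k) \<bullet> u"
  shows "ennreal a * emeasure \<phi> U \<le> emeasure (hyperplane_measure \<phi> 1) (separating_hyperplanes K x)"
proof -
  let ?A = "separating_hyperplanes K x"
  have A: "?A \<in> sets hyperplane_borel"
    using K by (intro openin_imp_sets_hyperplane_borel openin_separating_hyperplanes)
  note J = measurable_line_measure[OF A]
  have J': "(\<lambda>u. line_measure ?A (- u)) \<in> borel_measurable \<phi>"
    by (rule measurable_compose[OF measurable_uminus_\<phi> J])
  have "ennreal a * emeasure \<phi> U = (\<integral>\<^sup>+u. ennreal a * indicator U u \<partial>\<phi>)"
    using U by (simp add: nn_integral_cmult_indicator)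
  also have "\<dots> \<le> (\<integral>\<^sup>+u. line_measure ?A u + line_measure ?A (- u) \<partial>\<phi>)"
    using line_measure_separating_ge[OF K] U(2)
    by (intro nn_integral_mono) (auto simp: indicator_def space_\<phi>)
  also have "\<dots> = (\<integral>\<^sup>+u. line_measure ?A u \<partial>\<phi>) + (\<integral>\<^sup>+u. line_measure ?A (- u) \<partial>\<phi>)"
    using J J' by (rule nn_integral_add)
  also have "\<dots> = 2 * (\<integral>\<^sup>+u. line_measure ?A u \<partial>\<phi>)"
    by (simp add: nn_integral_even[OF J] mult_2)
  also have "\<dots> = emeasure (hyperplane_measure \<phi> 1) ?A"
    by (simp add: emeasure_hyperplane_measure[OF A])
  finally show ?thesis .
qed

lemma hyperplane_measure_near_0_finite:
  "emeasure (hyperplane_measure \<phi> 1) (hyperplanes_near_0 R) < \<infinity>"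
proof -
  interpret prob_space \<phi> by (rule \<phi>)
  have "line_measure (hyperplanes_near_0 R) u \<le> ennreal (max R 0)" if "u \<in> space \<phi>" for u
  proof -
    have u: "norm u = 1" using that by (simp add: space_\<phi>)
    have "hyperplane u t \<in> hyperplanes_near_0 R \<Longrightarrow> \<bar>t\<bar> < R" for t
      using u unfolding hyperplanes_near_0_def by (auto dest!: hyperplane_eq_cases[rotated 2])
    then have "line_measure (hyperplanes_near_0 R) u \<le> (\<integral>\<^sup>+t. indicator {0..max R 0} t \<partial>lborel)"
      unfolding line_measure_def by (intro nn_integral_mono) (force simp: indicator_def)
    also have "\<dots> = ennreal (max R 0)" by simp
    finally show ?thesis .
  qed
  then have "(\<integral>\<^sup>+u. line_measure (hyperplanes_near_0 R) u \<partial>\<phi>) \<le> (\<integral>\<^sup>+u. ennreal (max R 0) \<partial>\<phi>)"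
    by (rule nn_integral_mono)
  also have "\<dots> < \<infinity>" by (simp add: emeasure_space_1)
  finally show ?thesis
    by (simp add: emeasure_hyperplane_measure openin_imp_sets_hyperplane_borel openin_hyperplanes_near_0
      ennreal_mult_less_top)
qed

text \<open>The offset lies between those of \<open>x\<close> and of a point of \<open>K\<close>,
  hence in a bounded range. Finiteness matters because \<open>poisson_process\<close> prescribes the
  Poisson law for sets of finite intensity.\<close>

lemma hyperplane_measure_separating_finite:
  assumes "bounded K" "K \<noteq> {}"
  shows "emeasure (hyperplane_measure \<phi> 1) (separating_hyperplanes K x) < \<infinity>"
proof -
  obtain k where k: "k \<in> K" using assms(2) by blast
  have "separating_hyperplanes K x \<subseteq> hyperplanes_near_0 (norm x + norm k + 1)"
  proof
    fix H assume "H \<in> separating_hyperplanes K x"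
    then obtain u t where u: "norm u = 1" "H = hyperplane u t" "k \<bullet> u < t" "t < x \<bullet> u"
      unfolding separating_hyperplanes_def using k by blast
    have "\<bar>k \<bullet> u\<bar> \<le> norm k" "\<bar>x \<bullet> u\<bar> \<le> norm x"
      using Cauchy_Schwarz_ineq2[of k u] Cauchy_Schwarz_ineq2[of x u] u(1) by simp_all
    then have "\<bar>t\<bar> < norm x + norm k + 1" using u by linarith
    then show "H \<in> hyperplanes_near_0 (norm x + norm k + 1)"
      unfolding hyperplanes_near_0_def using u by blast
  qed
  then have "emeasure (hyperplane_measure \<phi> 1) (separating_hyperplanes K x)
      \<le> emeasure (hyperplane_measure \<phi> 1) (hyperplanes_near_0 (norm x + norm k + 1))"
    by (intro emeasure_mono)
      (auto simp: sets_hyperplane_measure openin_imp_sets_hyperplane_borel openin_hyperplanes_near_0)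
  then show ?thesis using hyperplane_measure_near_0_finite le_less_trans by blast
qed

lemma sigma_finite_hyperplane_measure: "sigma_finite_measure (hyperplane_measure \<phi> 1)"
proof
  let ?B = "\<lambda>n. hyperplanes_near_0 (real n) :: 'a set set"
  have "(\<Union>n. ?B n) = hyperplanes"
  proof (intro equalityI subsetI)
    fix H :: "'a set" assume "H \<in> hyperplanes"
    then obtain u t where u: "norm u = 1" "H = hyperplane u t" by (auto simp: hyperplanes_def)
    obtain n where "\<bar>t\<bar> < real n" using reals_Archimedean2 by blast
    then have "H \<in> ?B n" unfolding hyperplanes_near_0_def using u by blast
    then show "H \<in> (\<Union>n. ?B n)" by blast
  qed (auto simp: hyperplanes_near_0_def hyperplanes_def)
  moreover have "space (hyperplane_measure \<phi> 1) = hyperplanes"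
    using sets_eq_imp_space_eq[OF sets_hyperplane_measure] space_hyperplane_borel by metis
  ultimately show "\<exists>A. countable A \<and> A \<subseteq> sets (hyperplane_measure \<phi> 1) \<and> \<Union>A = space (hyperplane_measure \<phi> 1)
      \<and> (\<forall>a\<in>A. emeasure (hyperplane_measure \<phi> 1) a \<noteq> \<infinity>)"
    using hyperplane_measure_near_0_finite
    by (intro exI[of _ "range ?B"])
      (auto simp: sets_hyperplane_measure openin_imp_sets_hyperplane_borel openin_hyperplanes_near_0 less_top)
qed

lemma emeasure_time_hyperplane:
  assumes "0 \<le> r" "A \<in> sets hyperplane_borel"
  shows "{0..r} \<times> A \<in> sets (restrict_space lborel {0..} \<Otimes>\<^sub>M hyperplane_measure \<phi> 1)"
    "emeasure (restrict_space lborel {0..} \<Otimes>\<^sub>M hyperplane_measure \<phi> 1) ({0..r} \<times> A)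
      = ennreal r * emeasure (hyperplane_measure \<phi> 1) A"
proof -
  have I: "{0..r} \<in> sets (restrict_space lborel {0::real..})"
    by (auto simp: sets_restrict_space_iff)
  have A: "A \<in> sets (hyperplane_measure \<phi> 1)" using assms(2) by (simp add: sets_hyperplane_measure)
  show "{0..r} \<times> A \<in> sets (restrict_space lborel {0..} \<Otimes>\<^sub>M hyperplane_measure \<phi> 1)"
    using I A by (rule pair_measureI)
  have "emeasure (restrict_space lborel {0::real..}) {0..r} = ennreal r"
    using assms(1) by (subst emeasure_restrict_space) auto
  then show "emeasure (restrict_space lborel {0..} \<Otimes>\<^sub>M hyperplane_measure \<phi> 1) ({0..r} \<times> A)
      = ennreal r * emeasure (hyperplane_measure \<phi> 1) A"
    using sigma_finite_measure.emeasure_pair_measure_Times[OF sigma_finite_hyperplane_measure I A] by simp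
qed

end

section \<open>Supports of measures, halfspaces and the cell\<close>

text \<open>If \<open>U\<close> missed the support, it would be covered by countably many open null sets, the space of
  hyperplanes being Lindeloef.\<close>

lemma measure_support_hyperplane_meets:
  fixes U :: "'a::euclidean_space set set"
  assumes \<nu>: "sets \<nu> = sets hyperplane_borel"
    and U: "openin hyperplane_topology U" "emeasure \<nu> U \<noteq> 0"
  shows "\<exists>H\<in>U. H \<in> measure_support hyperplane_topology \<nu>"
proof (rule ccontr)
  assume *: "\<not> ?thesis"
  \<comment> \<open>Lifting to pairs (u, t) moves the covering argument into a subspace of a
    Euclidean space, where the Lindeloef property is available.\<close>
  define P where "P V = {(u, t). norm u = 1 \<and> hyperplane u t \<in> V}" for V :: "'a set set"
  define Z where "Z = {V. openin hyperplane_topology V \<and> emeasure \<nu> V = 0}"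
  have U_sub: "U \<subseteq> hyperplanes" using U by (simp add: openin_hyperplane_topology)
  obtain \<F> where \<F>: "\<F> \<subseteq> P ` Z" "countable \<F>" "\<Union>\<F> = \<Union>(P ` Z)"
  proof (rule Lindelof_openin[of "P ` Z" "unit_sphere \<times> UNIV"])
    show "openin (top_of_set (unit_sphere \<times> UNIV)) S" if "S \<in> P ` Z" for S
      using that by (auto simp: Z_def P_def openin_hyperplane_topology)
  qed
  obtain Y where Y: "countable Y" "Y \<subseteq> Z" "\<F> = P ` Y"
    using countable_subset_image[of \<F> P Z] \<F> by metis
  have "U \<subseteq> (\<Union>V\<in>Y. V)"
  proof
    fix H assume H: "H \<in> U"
    then obtain u t where ut: "norm u = 1" "H = hyperplane u t" using U_sub by (auto simp: hyperplanes_def)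
    have "H \<in> topspace hyperplane_topology" using H U_sub by (auto simp: topspace_hyperplane_topology)
    then obtain V where "openin hyperplane_topology V" "H \<in> V" "\<not> 0 < emeasure \<nu> V"
      using * H by (auto simp: measure_support_def)
    then have "V \<in> Z" "(u, t) \<in> P V" using ut by (auto simp: Z_def P_def zero_less_iff_neq_zero)
    then have "(u, t) \<in> \<Union>\<F>" using \<F>(3) by blast
    then show "H \<in> (\<Union>V\<in>Y. V)" using ut unfolding Y(3) P_def by auto
  qed
  moreover have "(\<Union>V\<in>Y. V) \<in> null_sets \<nu>"
    using Y by (intro null_sets_UN') (auto simp: Z_def null_sets_def \<nu> openin_imp_sets_hyperplane_borel)
  ultimately have "U \<in> null_sets \<nu>"
    using U \<nu> openin_imp_sets_hyperplane_borel by (intro null_sets_subset[of _ \<nu> U]) auto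
  then show False using U by auto
qed

text \<open>A connected set that misses a hyperplane lies on one side of it; the sign of the normal
  is then chosen to put \<open>K\<close> on the lower side.\<close>

lemma halfspace_containing_cases:
  assumes K: "convex K" "K \<noteq> {}" and H: "H \<in> hyperplanes" "H \<inter> K = {}"
  obtains u t where "norm u = 1" "halfspace_containing K H = {x. x \<bullet> u \<le> t}" "K \<subseteq> {x. x \<bullet> u \<le> t}"
proof -
  obtain u t where u: "norm u = 1" "H = hyperplane u t" using H by (auto simp: hyperplanes_def)
  have ne: "k \<bullet> u \<noteq> t" if "k \<in> K" for k using H(2) u that by (auto simp: hyperplane_def)
  have "(\<forall>k\<in>K. k \<bullet> u \<le> t) \<or> (\<forall>k\<in>K. t \<le> k \<bullet> u)"
  proof (rule ccontr)
    assume "\<not> ?thesis"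
    then obtain k l where kl: "k \<in> K" "l \<in> K" "u \<bullet> l \<le> t" "t \<le> u \<bullet> k" by (auto simp: not_le inner_commute)
    then obtain w where "w \<in> K" "u \<bullet> w = t"
      using connected_ivt_hyperplane[OF convex_connected[OF K(1)] kl(2,1,3,4)] by blast
    then show False using ne[of w] by (simp add: inner_commute)
  qed
  then show ?thesis
  proof
    assume *: "\<forall>k\<in>K. k \<bullet> u \<le> t"
    then have "halfspace_containing K H = {x. x \<bullet> u \<le> t}"
      unfolding u(2) using K u H by (intro halfspace_containing_eq) auto
    then show ?thesis using that u * by blast
  next
    assume *: "\<forall>k\<in>K. t \<le> k \<bullet> u"
    then have "halfspace_containing K H = {x. x \<bullet> (- u) \<le> - t}"
      unfolding u(2) hyperplane_minus[of u t, symmetric] using K u H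
      by (intro halfspace_containing_eq) (auto simp: hyperplane_minus)
    then show ?thesis using that[of "- u" "- t"] u * by auto
  qed
qed

lemma K_cell_convex_superset:
  assumes K: "convex K" "K \<noteq> {}" and X: "X \<subseteq> hyperplanes"
  shows "convex (K_cell K X)" "K \<subseteq> K_cell K X"
proof -
  have *: "convex (halfspace_containing K H) \<and> K \<subseteq> halfspace_containing K H"
    if H: "H \<in> X" "H \<inter> K = {}" for H
  proof -
    have "H \<in> hyperplanes" using H X by blast
    then obtain u t where u: "halfspace_containing K H = {x. x \<bullet> u \<le> t}" "K \<subseteq> {x. x \<bullet> u \<le> t}"
      using halfspace_containing_cases[OF K _ H(2)] by metis
    have "convex {x. x \<bullet> u \<le> t}" using convex_halfspace_le[of u t] by (simp add: inner_commute)
    then show ?thesis using u by simp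
  qed
  show "convex (K_cell K X)" "K \<subseteq> K_cell K X"
    unfolding K_cell_def using * by (auto intro!: convex_INT)
qed

lemma separating_hyperplane_excludes:
  assumes "K \<noteq> {}" "H \<in> X" "H \<in> separating_hyperplanes K x"
  shows "x \<notin> K_cell K X"
proof
  assume x: "x \<in> K_cell K X"
  obtain u t where u: "norm u = 1" "H = hyperplane u t" "\<forall>k\<in>K. k \<bullet> u < t" "t < x \<bullet> u"
    using assms(3) by (auto simp: separating_hyperplanes_def)
  have disj: "hyperplane u t \<inter> K = {}" using u by (force simp: hyperplane_def)
  have "halfspace_containing K H = {x. x \<bullet> u \<le> t}"
    unfolding u(2) using assms u disj by (intro halfspace_containing_eq) (auto intro: less_imp_le)
  then have "x \<bullet> u \<le> t" using x assms(2) disj u unfolding K_cell_def by auto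
  then show False using u by simp
qed

section \<open>Directions separating a point from a convex body\<close>

text \<open>For nonempty compact \<open>K\<close> the condition says that x . u exceeds the support
  function of \<open>K\<close> at u by at least \<open>a\<close>. This is the set U of the overview,
  and \<open>a\<close> is a lower bound for the range of separating offsets.\<close>

definition separating_directions :: "'a::euclidean_space set \<Rightarrow> 'a \<Rightarrow> real \<Rightarrow> 'a set" where
  "separating_directions K x a = {u \<in> unit_sphere. \<forall>k\<in>K. a \<le> (x - k) \<bullet> u}"

lemma closed_separating_directions: "closed (separating_directions K x a)"
proof -
  have "separating_directions K x a = unit_sphere \<inter> (\<Inter>k\<in>K. {u. a \<le> (x - k) \<bullet> u})"
    by (auto simp: separating_directions_def)
  then show ?thesis by (auto intro!: closed_Collect_le continuous_intros)
qed

lemma sets_separating_directions: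
  "separating_directions K x a \<in> sets sphere_borel"
  using closed_separating_directions[of K x a]
  by (auto simp: sets_restrict_space_iff separating_directions_def)

text \<open>The margin \<open>a\<close> may vary with \<open>x\<close>, the constants may not. The
  bound says that the intensity of hyperplanes separating \<open>x\<close> from \<open>K\<close> is
  at least of order distance to the power p.\<close>

definition separation_rate :: "'a::euclidean_space set \<Rightarrow> 'a measure \<Rightarrow> real \<Rightarrow> bool" where
  "separation_rate K \<phi> p \<longleftrightarrow> (\<exists>c>0. \<exists>\<eta>\<^sub>0>0. \<forall>x. 0 < infdist x K \<longrightarrow> infdist x K \<le> \<eta>\<^sub>0 \<longrightarrow>
     (\<exists>a>0. ennreal (c * infdist x K powr p) \<le> ennreal a * emeasure \<phi> (separating_directions K x a)))"

text \<open>The central projection of the ball from \<open>z\<close> to the boundary, when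
  \<open>z\<close> is interior to the convex body \<open>K\<close> and the ball misses
  \<open>K\<close>.\<close>

definition shadow :: "'a::euclidean_space set \<Rightarrow> 'a \<Rightarrow> 'a \<Rightarrow> real \<Rightarrow> 'a set" where
  "shadow K z q\<^sub>0 \<rho> = {y \<in> frontier K. \<exists>q\<in>ball q\<^sub>0 \<rho>. y \<in> closed_segment z q}"

lemma hausdorff_measure_mono:
  assumes "A \<subseteq> B"
  shows "hausdorff_measure k A \<le> hausdorff_measure k B"
  unfolding hausdorff_measure_def
proof (rule SUP_subset_mono[OF order_refl])
  fix \<epsilon> :: real
  show "hausdorff_premeasure k \<epsilon> A \<le> hausdorff_premeasure k \<epsilon> B"
    unfolding hausdorff_premeasure_def
    by (rule INF_superset_mono[OF _ order_refl]) (use assms in blast)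
qed

lemma in_closed_segmentE:
  assumes "y \<in> closed_segment z q"
  obtains s where "0 \<le> s" "s \<le> 1" "y = z + s *\<^sub>R (q - z)"
  using assms unfolding in_segment by (auto simp: algebra_simps)

lemma slides_freely_cballE:
  assumes "slides_freely_inside (cball c r) K" "y \<in> K"
  obtains z where "cball z r \<subseteq> K" "y \<in> cball z r"
proof -
  obtain v where v: "(+) v ` cball c r \<subseteq> K" "y \<in> (+) v ` cball c r"
    using assms unfolding slides_freely_inside_def by blast
  have "(+) v ` cball c r = cball (v + c) r" by (rule cball_translation[symmetric])
  then show ?thesis using that v by metis
qed

lemma nearest_point:
  fixes K :: "'a::euclidean_space set"
  assumes "closed K" "convex K" "K \<noteq> {}" "0 < infdist x K"
  obtains p u where "p \<in> K" "norm u = 1" "x = p + infdist x K *\<^sub>R u" "\<And>k. k \<in> K \<Longrightarrow> (k - p) \<bullet> u \<le> 0"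
proof -
  obtain p where p: "p \<in> K" "infdist x K = dist x p"
    using infdist_attains_inf[OF assms(1,3)] by blast
  define u where "u = (1 / infdist x K) *\<^sub>R (x - p)"
  have "norm u = 1" using p assms(4) by (simp add: u_def dist_norm)
  moreover have "x = p + infdist x K *\<^sub>R u" using assms(4) by (simp add: u_def)
  moreover have "(k - p) \<bullet> u \<le> 0" if "k \<in> K" for k
  proof -
    have "(x - p) \<bullet> (k - p) \<le> 0"
      using p that infdist_le by (intro any_closest_point_dot[OF assms(2,1)]) (auto simp flip: p(2))
    then show ?thesis using assms(4)
      by (simp add: u_def inner_commute divide_nonpos_pos)
  qed
  ultimately show ?thesis using that p by blast
qed

section \<open>Convex bodies between two concentric balls: rays and outer normals\<close>

locale nested_balls =
  fixes K :: "'a::euclidean_space set" and z :: 'a and r D :: real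
  assumes dim: "2 \<le> DIM('a)"
    and K: "compact K" "convex K"
    and r: "0 < r" "cball z r \<subseteq> K"
    and D: "K \<subseteq> cball z D"
begin

lemma r_le_D: "r \<le> D"
  using order_trans[OF r(2) D] r(1) by (simp add: cball_subset_cball_iff)

lemma D_pos: "0 < D"
  using r_le_D r(1) by linarith

lemma z_in_K: "z \<in> K" using r by auto

lemma closed_K: "closed K" using K compact_imp_closed by blast

lemma z_interior: "z \<in> interior K"
  using r interior_mono[OF r(2)] by (auto simp: interior_cball)

lemma frontier_subset_K: "frontier K \<subseteq> K"
  using closed_K frontier_subset_closed by blast

lemma outer_normal_exists:
  assumes "y \<in> frontier K"
  obtains u where "outer_unit_normal K y u"
proof -
  have "y \<in> K" using assms frontier_subset_K by blast
  moreover have "y \<notin> rel_interior K"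
    using assms z_interior rel_interior_nonempty_interior[of K] by (auto simp: frontier_def)
  ultimately obtain a where a: "a \<noteq> 0" "\<And>w. w \<in> K \<Longrightarrow> a \<bullet> y \<le> a \<bullet> w"
    using supporting_hyperplane_rel_boundary[OF K(2)] by metis
  \<comment> \<open>The supporting functional \<open>a\<close> is minimal at \<open>y\<close>, so it
    points inwards and its sign is reversed.\<close>
  have "outer_unit_normal K y ((- 1 / norm a) *\<^sub>R a)"
    unfolding outer_unit_normal_def using a
    by (auto simp: inner_diff_left inner_diff_right inner_commute field_simps)
  then show ?thesis using that by blast
qed

text \<open>The point z + r u of the inner ball lies in \<open>K\<close>, hence below the supporting
  hyperplane at \<open>y\<close>.\<close>

lemma normal_distance:
  assumes "outer_unit_normal K y u"
  shows "r \<le> (y - z) \<bullet> u"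
proof -
  have u: "norm u = 1" "\<And>k. k \<in> K \<Longrightarrow> (k - y) \<bullet> u \<le> 0"
    using assms by (auto simp: outer_unit_normal_def)
  have "z + r *\<^sub>R u \<in> K" using r u by (auto simp: dist_norm)
  then have "(z + r *\<^sub>R u - y) \<bullet> u \<le> 0" by (rule u)
  moreover have "u \<bullet> u = 1" using u by (simp add: dot_square_norm)
  ultimately show ?thesis by (simp add: inner_add_left inner_diff_left)
qed

text \<open>A ray from \<open>z\<close> crosses the supporting hyperplane at \<open>y\<close>
  transversally: along it the height above that hyperplane grows at slope at least r / dist z q.
  Indeed s (q - z) . u >= r with s <= 1 forces (q - z) . u >= r, and q - y is a multiple of q -
  z.\<close>

lemma normal_visible:
  assumes "y \<in> closed_segment z q" "outer_unit_normal K y u"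
  shows "r * dist q y \<le> dist z q * ((q - y) \<bullet> u)"
proof -
  obtain s where s: "0 \<le> s" "s \<le> 1" "y = z + s *\<^sub>R (q - z)"
    using assms(1) by (rule in_closed_segmentE)
  have X: "r \<le> s * ((q - z) \<bullet> u)" using normal_distance[OF assms(2)] s by simp
  have "0 < (q - z) \<bullet> u" using X r s(1)
    by (smt (verit) mult_nonneg_nonpos)
  then have "s * ((q - z) \<bullet> u) \<le> (q - z) \<bullet> u" using s by (simp add: mult_left_le_one_le)
  then have "r \<le> (q - z) \<bullet> u" using X by linarith
  then have "(1 - s) * r \<le> (1 - s) * ((q - z) \<bullet> u)" using s by (intro mult_left_mono) auto
  moreover have e: "q - y = (1 - s) *\<^sub>R (q - z)" using s by (simp add: algebra_simps)
  moreover have "dist q y = (1 - s) * dist z q"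
    using s unfolding dist_norm e by (simp add: norm_minus_commute)
  ultimately show ?thesis
    by (smt (verit) inner_scaleR_left mult.commute mult.left_commute mult_left_mono zero_le_dist)
qed

section \<open>Size of boundary patches seen from an interior point\<close>

text \<open>A segment from \<open>z\<close> to a point of the ball has length at most E + 1 and
  stays in the interior of \<open>K\<close> up to distance r, so it meets the boundary at parameter
  at least r / (E + 1). The cone over the ball cut off at that parameter therefore lies in the cone
  over the shadow.\<close>

lemma cone_over_shadow_volume_ge:
  "\<exists>c>0. \<forall>q\<^sub>0 \<rho>. 0 < \<rho> \<longrightarrow> \<rho> \<le> 1 \<longrightarrow> dist z q\<^sub>0 \<le> E \<longrightarrow> ball q\<^sub>0 \<rho> \<inter> K = {} \<longrightarrow>
    (\<exists>T. open T \<and> T \<subseteq> cone_over z (shadow K z q\<^sub>0 \<rho>) \<and>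
      ennreal (c * \<rho> ^ (DIM('a) - 1)) \<le> emeasure lborel T)"
proof (cases "0 \<le> E")
  case False
  then show ?thesis by (intro exI[of _ 1]) (smt (verit) zero_le_dist)
next
  case True
  have "0 < r / (E + 1)" using r True by simp
  from cone_over_ball_volume_ge[OF r(1) this] obtain c where c: "c > 0"
    and vol: "\<forall>(z :: 'a) q\<^sub>0 \<rho>. r \<le> dist z q\<^sub>0 \<longrightarrow> 0 < \<rho> \<longrightarrow>
    (\<exists>T. open T \<and> T \<subseteq> {z + s *\<^sub>R (q - z) | s q. 0 \<le> s \<and> s \<le> r / (E + 1) \<and> q \<in> ball q\<^sub>0 \<rho>} \<and>
      ennreal (c * \<rho> ^ (DIM('a) - 1)) \<le> emeasure lborel T)"
    by (elim exE conjE)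
  have "\<exists>T. open T \<and> T \<subseteq> cone_over z (shadow K z q\<^sub>0 \<rho>) \<and>
      ennreal (c * \<rho> ^ (DIM('a) - 1)) \<le> emeasure lborel T"
    if \<rho>: "0 < \<rho>" "\<rho> \<le> 1" "dist z q\<^sub>0 \<le> E" "ball q\<^sub>0 \<rho> \<inter> K = {}" for q\<^sub>0 \<rho>
  proof -
    have "q\<^sub>0 \<in> ball q\<^sub>0 \<rho>" using \<rho> by simp
    then have "q\<^sub>0 \<notin> cball z r" using \<rho>(4) r by blast
    then have "r \<le> dist z q\<^sub>0" by simp
    moreover have "{z + s *\<^sub>R (q - z) | s q. 0 \<le> s \<and> s \<le> r / (E + 1) \<and> q \<in> ball q\<^sub>0 \<rho>}
        \<subseteq> cone_over z (shadow K z q\<^sub>0 \<rho>)"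
    proof clarify
      fix s q assume s: "0 \<le> s" "s \<le> r / (E + 1)" and q: "q \<in> ball q\<^sub>0 \<rho>"
      have "q \<notin> K" using q \<rho>(4) by blast
      then have "closed_segment z q \<inter> frontier K \<noteq> {}"
        using z_in_K by (intro connected_Int_frontier) auto
      then obtain y where y: "y \<in> closed_segment z q" "y \<in> frontier K" by blast
      then obtain t where t: "0 \<le> t" "t \<le> 1" "y = z + t *\<^sub>R (q - z)" by (auto elim: in_closed_segmentE)
      have "y \<notin> ball z r" using y(2) interior_mono[OF r(2)] by (auto simp: frontier_def interior_cball)
      then have "r \<le> t * dist z q" using t by (simp add: dist_norm norm_minus_commute)
      moreover have dq: "dist z q \<le> E + 1" using q \<rho> dist_triangle[of z q q\<^sub>0] by auto
      ultimately have "r \<le> t * (E + 1)" using t mult_left_mono[OF dq, of t] by linarith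
      then have "r / (E + 1) \<le> t" using True by (simp add: field_simps)
      moreover have "0 < r / (E + 1)" using r True by simp
      ultimately have st: "s \<le> t" "0 < t" using s by linarith+
      have "z + s *\<^sub>R (q - z) = z + (s / t) *\<^sub>R (y - z)" using t st by simp
      moreover have "y \<in> shadow K z q\<^sub>0 \<rho>" using y q by (auto simp: shadow_def)
      ultimately show "z + s *\<^sub>R (q - z) \<in> cone_over z (shadow K z q\<^sub>0 \<rho>)"
        unfolding cone_over_def using st s
        by (intro CollectI exI[of _ "s / t"] exI[of _ y]) auto
    qed
    ultimately show ?thesis
      using vol[rule_format, of z q\<^sub>0 \<rho>] \<rho>(1) by (auto elim!: order_trans)
  qed
  then show ?thesis using c by blast
qed

lemma hausdorff_measure_shadow_ge:
  "\<exists>c>0. \<forall>q\<^sub>0 \<rho>. 0 < \<rho> \<longrightarrow> \<rho> \<le> 1 \<longrightarrow> dist z q\<^sub>0 \<le> E \<longrightarrow> ball q\<^sub>0 \<rho> \<inter> K = {} \<longrightarrow>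
    ennreal (c * \<rho> ^ (DIM('a) - 1)) \<le> hausdorff_measure (DIM('a) - 1) (shadow K z q\<^sub>0 \<rho>)"
proof -
  from hausdorff_measure_ge_cone_volume[OF dim, of D] obtain c\<^sub>1 where c1: "c\<^sub>1 > 0"
    and H: "\<forall>(z :: 'a) Y T. Y \<subseteq> cball z D \<longrightarrow> T \<in> sets borel \<longrightarrow> T \<subseteq> cone_over z Y \<longrightarrow>
      ennreal c\<^sub>1 * emeasure lborel T \<le> hausdorff_measure (DIM('a) - 1) Y"
    by (elim exE conjE)
  from cone_over_shadow_volume_ge[of E] obtain c\<^sub>2 where c2: "c\<^sub>2 > 0"
    and vol: "\<forall>q\<^sub>0 \<rho>. 0 < \<rho> \<longrightarrow> \<rho> \<le> 1 \<longrightarrow> dist z q\<^sub>0 \<le> E \<longrightarrow> ball q\<^sub>0 \<rho> \<inter> K = {} \<longrightarrow>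
    (\<exists>T. open T \<and> T \<subseteq> cone_over z (shadow K z q\<^sub>0 \<rho>) \<and>
      ennreal (c\<^sub>2 * \<rho> ^ (DIM('a) - 1)) \<le> emeasure lborel T)"
    by (elim exE conjE)
  have "ennreal (c\<^sub>1 * c\<^sub>2 * \<rho> ^ (DIM('a) - 1)) \<le> hausdorff_measure (DIM('a) - 1) (shadow K z q\<^sub>0 \<rho>)"
    if \<rho>: "0 < \<rho>" "\<rho> \<le> 1" "dist z q\<^sub>0 \<le> E" "ball q\<^sub>0 \<rho> \<inter> K = {}" for q\<^sub>0 \<rho>
  proof -
    obtain T where T: "open T" "T \<subseteq> cone_over z (shadow K z q\<^sub>0 \<rho>)"
      "ennreal (c\<^sub>2 * \<rho> ^ (DIM('a) - 1)) \<le> emeasure lborel T"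
      using vol[rule_format, OF \<rho>] by (elim exE conjE)
    have "ennreal (c\<^sub>1 * c\<^sub>2 * \<rho> ^ (DIM('a) - 1)) = ennreal c\<^sub>1 * ennreal (c\<^sub>2 * \<rho> ^ (DIM('a) - 1))"
      using c1 by (simp add: mult.assoc flip: ennreal_mult')
    also have "\<dots> \<le> ennreal c\<^sub>1 * emeasure lborel T" by (intro mult_left_mono T) simp
    also have "\<dots> \<le> hausdorff_measure (DIM('a) - 1) (shadow K z q\<^sub>0 \<rho>)"
      using T D frontier_subset_K by (intro H[rule_format]) (auto simp: shadow_def)
    finally show ?thesis .
  qed
  then show ?thesis using c1 c2 by (intro exI[of _ "c\<^sub>1 * c\<^sub>2"]) auto
qed

text \<open>Every boundary point has some outer normal, so controlling all normals on the shadow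
  puts the whole shadow into the set that defines the surface area measure of
  \<open>U\<close>.\<close>

lemma surface_area_measure_ge_shadow:
  assumes "\<And>y u. y \<in> shadow K z q\<^sub>0 \<rho> \<Longrightarrow> outer_unit_normal K y u \<Longrightarrow> u \<in> U"
  shows "hausdorff_measure (DIM('a) - 1) (shadow K z q\<^sub>0 \<rho>) \<le> surface_area_measure K U"
proof -
  have "shadow K z q\<^sub>0 \<rho> \<subseteq> {y \<in> frontier K. \<exists>u\<in>U. outer_unit_normal K y u}"
  proof
    fix y assume y: "y \<in> shadow K z q\<^sub>0 \<rho>"
    then have "y \<in> frontier K" by (simp add: shadow_def)
    moreover from this obtain u where "outer_unit_normal K y u" by (rule outer_normal_exists)
    ultimately show "y \<in> {y \<in> frontier K. \<exists>u\<in>U. outer_unit_normal K y u}"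
      using assms[OF y] by blast
  qed
  then show ?thesis
    unfolding surface_area_measure_def by (rule hausdorff_measure_mono)
qed

lemma infdist_imp_dist_le: "dist z x \<le> D + infdist x K"
proof -
  obtain p where p: "p \<in> K" "infdist x K = dist x p"
    using infdist_attains_inf[OF closed_K, of x] z_in_K by blast
  then show ?thesis using D dist_triangle[of z x p] by (auto simp: dist_commute)
qed

section \<open>Exponent d for surface area measure and for spherical Lebesgue measure\<close>

text \<open>With this radius, \<open>q\<close> has distance at least \<open>infdist x K / 2\<close>
  from \<open>y\<close>, so \<open>normal_visible\<close> lifts \<open>q\<close> above the
  supporting hyperplane by at least 2 \<rho>. Passing from \<open>q\<close> to \<open>x\<close>
  loses at most \<rho>.\<close>

lemma shadow_normal_separates:
  assumes x: "0 < infdist x K" "infdist x K \<le> 1" and \<rho>: "\<rho> = r / (4 * (D + 2)) * infdist x K"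
  shows "0 < \<rho>" "\<rho> \<le> 1" "dist z x \<le> D + 1" "ball x \<rho> \<inter> K = {}"
    "\<And>y u. y \<in> shadow K z x \<rho> \<Longrightarrow> outer_unit_normal K y u \<Longrightarrow> u \<in> separating_directions K x \<rho>"
proof -
  have q: "0 < r / (4 * (D + 2))" "r / (4 * (D + 2)) \<le> 1 / 4" using D_pos r r_le_D by (auto simp: field_simps)
  show "0 < \<rho>" unfolding \<rho> using x q by (intro mult_pos_pos)
  have rho: "\<rho> \<le> 1 / 4 * infdist x K" unfolding \<rho> using q x by (intro mult_right_mono) auto
  then show "\<rho> \<le> 1" using x by simp
  show zx: "dist z x \<le> D + 1" using infdist_imp_dist_le[of x] x by linarith
  show disj: "ball x \<rho> \<inter> K = {}"
  proof safe
    fix k assume "k \<in> ball x \<rho>" "k \<in> K"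
    then have "infdist x K < 1 / 4 * infdist x K" using rho infdist_le[of k K x] by simp
    then show "k \<in> {}" using x by simp
  qed
  fix y u assume y: "y \<in> shadow K z x \<rho>" and u: "outer_unit_normal K y u"
  obtain q where q: "q \<in> ball x \<rho>" "y \<in> closed_segment z q" using y by (auto simp: shadow_def)
  have yK: "y \<in> K" using y frontier_subset_K by (auto simp: shadow_def)
  have nu: "norm u = 1" "\<And>k. k \<in> K \<Longrightarrow> (k - y) \<bullet> u \<le> 0"
    using u by (auto simp: outer_unit_normal_def)
  have zq: "dist z q \<le> D + 2"
    using q zx \<open>\<rho> \<le> 1\<close> dist_triangle[of z q x] by auto
  have "infdist x K \<le> dist x y" using yK by (rule infdist_le)
  also have "\<dots> \<le> dist x q + dist q y" by (rule dist_triangle)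
  finally have "infdist x K / 2 \<le> dist q y" using q rho x by auto
  then have "r * (infdist x K / 2) \<le> r * dist q y" using r by (intro mult_left_mono) auto
  also have vis: "\<dots> \<le> dist z q * ((q - y) \<bullet> u)" by (rule normal_visible[OF q(2) u])
  also have "\<dots> \<le> (D + 2) * ((q - y) \<bullet> u)"
  proof (rule mult_right_mono[OF zq])
    have "0 \<le> dist z q * ((q - y) \<bullet> u)" using vis r by (smt (verit) mult_nonneg_nonneg zero_le_dist)
    moreover have "dist z q > 0" using q(1) disj z_in_K by auto
    ultimately show "0 \<le> (q - y) \<bullet> u" by (simp add: zero_le_mult_iff)
  qed
  finally have "2 * \<rho> \<le> (q - y) \<bullet> u" unfolding \<rho> using D_pos by (simp add: field_simps)
  moreover have "\<bar>(x - q) \<bullet> u\<bar> \<le> norm (x - q) * norm u" by (rule Cauchy_Schwarz_ineq2)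
  then have "- \<rho> \<le> (x - q) \<bullet> u" using q nu by (auto simp: dist_norm)
  ultimately have *: "\<rho> \<le> (x - y) \<bullet> u" by (simp add: inner_diff_left)
  show "u \<in> separating_directions K x \<rho>"
    unfolding separating_directions_def
  proof (intro CollectI conjI ballI)
    fix k assume "k \<in> K"
    then show "\<rho> \<le> (x - k) \<bullet> u" using nu(2)[of k] * by (simp add: inner_diff_left)
  qed (use nu in auto)
qed

text \<open>The margin \<rho> times a patch measure of order \<rho> to the power d - 1, with \<rho>
  proportional to the distance, gives exponent d.\<close>

lemma separation_rate_surface:
  assumes \<phi>: "sets \<phi> = sets sphere_borel" and b: "b > 0" "setwise_ge \<phi> b (surface_area_measure K)"
  shows "separation_rate K \<phi> (real DIM('a))"
proof -
  from hausdorff_measure_shadow_ge[of "D + 1"] obtain c where c: "c > 0"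
    and H: "\<forall>q\<^sub>0 \<rho>. 0 < \<rho> \<longrightarrow> \<rho> \<le> 1 \<longrightarrow> dist z q\<^sub>0 \<le> D + 1 \<longrightarrow> ball q\<^sub>0 \<rho> \<inter> K = {} \<longrightarrow>
    ennreal (c * \<rho> ^ (DIM('a) - 1)) \<le> hausdorff_measure (DIM('a) - 1) (shadow K z q\<^sub>0 \<rho>)"
    by (elim exE conjE)
  define \<kappa> where "\<kappa> = r / (4 * (D + 2))"
  have \<kappa>: "\<kappa> > 0" using r D_pos by (simp add: \<kappa>_def)
  have "\<exists>a>0. ennreal (b * c * \<kappa> ^ DIM('a) * infdist x K powr real DIM('a))
      \<le> ennreal a * emeasure \<phi> (separating_directions K x a)"
    if x: "0 < infdist x K" "infdist x K \<le> 1" for x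
  proof -
    define \<rho> where "\<rho> = r / (4 * (D + 2)) * infdist x K"
    note S = shadow_normal_separates[OF x \<rho>_def]
    have "ennreal b * ennreal (c * \<rho> ^ (DIM('a) - 1))
        \<le> ennreal b * surface_area_measure K (separating_directions K x \<rho>)"
      using order_trans[OF H[rule_format, OF S(1-4)] surface_area_measure_ge_shadow[OF S(5)]]
      by (intro mult_left_mono) auto
    also have "\<dots> \<le> emeasure \<phi> (separating_directions K x \<rho>)"
      using b(2) sets_separating_directions \<phi> by (auto simp: setwise_ge_def)
    finally have "ennreal \<rho> * (ennreal b * ennreal (c * \<rho> ^ (DIM('a) - 1)))
        \<le> ennreal \<rho> * emeasure \<phi> (separating_directions K x \<rho>)"
      by (intro mult_left_mono) auto
    moreover have "ennreal \<rho> * (ennreal b * ennreal (c * \<rho> ^ (DIM('a) - 1)))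
        = ennreal (b * c * \<rho> ^ DIM('a))"
      using S(1) b c by (simp add: power_eq_if mult_ac flip: ennreal_mult')
    moreover have "\<rho> ^ DIM('a) = \<kappa> ^ DIM('a) * infdist x K powr real DIM('a)"
      unfolding \<rho>_def \<kappa>_def power_mult_distrib using x by (simp add: powr_realpow)
    ultimately show ?thesis using S(1) by (intro exI[of _ \<rho>]) (simp add: mult.assoc)
  qed
  then show ?thesis unfolding separation_rate_def using b c \<kappa>
    by (intro exI[of _ "b * c * \<kappa> ^ DIM('a)"] conjI exI[of _ 1]) auto
qed


text \<open>All directions within 2 \<rho> of the direction \<open>v\<close> from the nearest point
  of \<open>K\<close> to \<open>x\<close> separate with margin \<eta> / 2. The cone over this cap
  contains a truncated cone over a ball of radius \<rho> around \<open>v\<close>, so its volume is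
  at least of order \<rho> to the power d - 1.\<close>

lemma separation_rate_sphere:
  assumes \<phi>: "sets \<phi> = sets sphere_borel" and b: "b > 0" "setwise_ge \<phi> b spherical_lebesgue"
  shows "separation_rate K \<phi> (real DIM('a))"
proof -
  have "(0::real) < 1" "0 < 1 / (2::real)" by simp_all
  from cone_over_ball_volume_ge[OF this] obtain c where c: "c > 0"
    and vol: "\<forall>(z :: 'a) q\<^sub>0 \<rho>. 1 \<le> dist z q\<^sub>0 \<longrightarrow> 0 < \<rho> \<longrightarrow>
    (\<exists>T. open T \<and> T \<subseteq> {z + s *\<^sub>R (q - z) | s q. 0 \<le> s \<and> s \<le> 1 / 2 \<and> q \<in> ball q\<^sub>0 \<rho>} \<and>
      ennreal (c * \<rho> ^ (DIM('a) - 1)) \<le> emeasure lborel T)"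
    by (elim exE conjE)
  \<comment> \<open>Makes (2 D + 1) * 2 \<rho> equal to \<eta> / 2: the change in the inner product
    with x - k, of norm at most 2 D + 1, when the direction moves by 2 \<rho>.\<close>
  define \<kappa> where "\<kappa> = 1 / (4 * (2 * D + 1))"
  have \<kappa>: "0 < \<kappa>" "\<kappa> \<le> 1 / 4" using D_pos by (auto simp: \<kappa>_def field_simps)
  have "\<exists>a>0. ennreal (b * c * \<kappa> ^ (DIM('a) - 1) / 2 * infdist x K powr real DIM('a))
      \<le> ennreal a * emeasure \<phi> (separating_directions K x a)"
    if x: "0 < infdist x K" "infdist x K \<le> 1" for x
  proof -
    define \<eta> where "\<eta> = infdist x K"
    define \<rho> where "\<rho> = \<kappa> * \<eta>"
    have \<eta>: "0 < \<eta>" "\<eta> \<le> 1" using x by (auto simp: \<eta>_def)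
    have \<rho>: "0 < \<rho>" "\<rho> \<le> 1 / 4"
      using \<kappa> \<eta> mult_mono[of \<kappa> "1/4" \<eta> 1] by (auto simp: \<rho>_def)
    obtain p v where p: "p \<in> K" "norm v = 1" "x = p + \<eta> *\<^sub>R v" "\<And>k. k \<in> K \<Longrightarrow> (k - p) \<bullet> v \<le> 0"
      using nearest_point[OF closed_K K(2) _ x(1)] z_in_K unfolding \<eta>_def by blast
    define U where "U = separating_directions K x (\<eta> / 2)"
    have cap: "u \<in> U" if u: "norm u = 1" "norm (u - v) \<le> 2 * \<rho>" for u
      unfolding U_def separating_directions_def
    proof (intro CollectI conjI ballI)
      fix k assume k: "k \<in> K"
      have "norm (x - k) \<le> norm (p - k) + norm (\<eta> *\<^sub>R v)"
        unfolding p(3) using norm_triangle_ineq[of "p - k" "\<eta> *\<^sub>R v"] by (simp add: algebra_simps)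
      also have "norm (p - k) \<le> norm (p - z) + norm (z - k)"
        using norm_triangle_ineq[of "p - z" "z - k"] by simp
      finally have "norm (x - k) \<le> norm (p - z) + norm (z - k) + norm (\<eta> *\<^sub>R v)" by simp
      moreover have "norm (p - z) \<le> D" "norm (z - k) \<le> D"
        using p(1) k D by (auto simp: subset_eq dist_norm norm_minus_commute)
      moreover have "norm (\<eta> *\<^sub>R v) \<le> 1" using p(2) \<eta> by simp
      ultimately have "norm (x - k) \<le> 2 * D + 1" by linarith
      then have "norm (x - k) * norm (u - v) \<le> (2 * D + 1) * (2 * \<rho>)"
        using u D_pos by (intro mult_mono) auto
      also have "\<dots> = \<eta> / 2" using D_pos by (simp add: \<rho>_def \<kappa>_def field_simps)
      finally have "\<bar>(x - k) \<bullet> (u - v)\<bar> \<le> \<eta> / 2"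
        using Cauchy_Schwarz_ineq2[of "x - k" "u - v"] by linarith
      moreover have "(x - k) \<bullet> u = (x - k) \<bullet> (u - v) + \<eta> - (k - p) \<bullet> v"
        using p(2) by (simp add: p(3) inner_diff_left inner_diff_right inner_add_left dot_square_norm)
      ultimately show "\<eta> / 2 \<le> (x - k) \<bullet> u" using p(4)[OF k] by linarith
    qed (use u in auto)
    have v1: "1 \<le> dist 0 v" using p by simp
    obtain T where T: "open T"
      "T \<subseteq> {0 + s *\<^sub>R (q - 0) | s q. 0 \<le> s \<and> s \<le> 1 / 2 \<and> q \<in> ball v \<rho>}"
      "ennreal (c * \<rho> ^ (DIM('a) - 1)) \<le> emeasure lborel T"
      using vol[rule_format, OF v1 \<rho>(1)] by (elim exE conjE)
    have "T \<subseteq> cone_over 0 U"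
    proof
      fix w assume "w \<in> T"
      then have "w \<in> {0 + s *\<^sub>R (q - 0) | s q. 0 \<le> s \<and> s \<le> 1 / 2 \<and> q \<in> ball v \<rho>}"
        using T(2) by blast
      then obtain s q where s: "0 \<le> s" "s \<le> 1 / 2" "w = s *\<^sub>R q" and "q \<in> ball v \<rho>" by auto
      then have q: "norm (q - v) < \<rho>" by (simp add: dist_norm norm_minus_commute)
      have nq: "\<bar>norm q - 1\<bar> < \<rho>" using norm_triangle_ineq3[of q v] p(2) q by linarith
      then have pos: "0 < norm q" using \<rho> by linarith
      define u where "u = (1 / norm q) *\<^sub>R q"
      have qu: "q = norm q *\<^sub>R u" using pos by (simp add: u_def)
      have "norm u = 1" using pos by (simp add: u_def)
      moreover have "norm (u - v) \<le> norm (u - q) + norm (q - v)"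
        using norm_triangle_ineq[of "u - q" "q - v"] by simp
      moreover have "u - q = (1 - norm q) *\<^sub>R u" using qu by (simp add: scaleR_diff_left)
      then have "norm (u - q) = \<bar>1 - norm q\<bar>" using \<open>norm u = 1\<close> by simp
      ultimately have "u \<in> U" using nq q by (intro cap) auto
      \<comment> \<open>Truncating at s <= 1 / 2 leaves room for the factor norm q, which is at most
        2, when \<open>q\<close> is normalised.\<close>
      moreover have "s * norm q \<le> 1 / 2 * 2" using s nq \<rho> by (intro mult_mono) auto
      moreover have "w = 0 + (s * norm q) *\<^sub>R (u - 0)" unfolding s(3) by (subst qu) simp
      ultimately show "w \<in> cone_over 0 U" unfolding cone_over_def using s
        by (intro CollectI exI[of _ "s * norm q"] exI[of _ u]) auto
    qed
    moreover have "U = sphere 0 1 \<inter> U" by (auto simp: U_def separating_directions_def)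
    then have "compact U"
      using compact_Int_closed[OF compact_sphere closed_separating_directions] unfolding U_def by metis
    then have "cone_over 0 U \<in> sets lborel"
      using compact_cone_over compact_imp_closed borel_closed by auto
    ultimately have "emeasure lborel T \<le> emeasure lborel (cone_over 0 U)" by (intro emeasure_mono)
    also have "\<dots> \<le> of_nat DIM('a) * emeasure lborel (cone_over 0 U)"
    proof -
      have "(of_nat 1 :: ennreal) \<le> of_nat DIM('a)" using dim by (intro of_nat_mono) simp
      from mult_right_mono[OF this, of "emeasure lborel (cone_over 0 U)"] show ?thesis by simp
    qed
    also have "\<dots> = spherical_lebesgue U"
      by (simp add: spherical_lebesgue_def cone_over_def)
    finally have "ennreal b * ennreal (c * \<rho> ^ (DIM('a) - 1)) \<le> ennreal b * spherical_lebesgue U"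
      using T(3) by (intro mult_left_mono order_trans[OF T(3)]) auto
    also have "\<dots> \<le> emeasure \<phi> U"
      using b(2) sets_separating_directions \<phi> by (auto simp: setwise_ge_def U_def)
    finally have "ennreal (\<eta> / 2) * (ennreal b * ennreal (c * \<rho> ^ (DIM('a) - 1)))
        \<le> ennreal (\<eta> / 2) * emeasure \<phi> U"
      by (intro mult_left_mono) auto
    moreover have "ennreal (\<eta> / 2) * (ennreal b * ennreal (c * \<rho> ^ (DIM('a) - 1)))
        = ennreal (b * c * \<kappa> ^ (DIM('a) - 1) / 2 * (\<eta> * \<eta> ^ (DIM('a) - 1)))"
      using \<eta> b c by (simp add: \<rho>_def power_mult_distrib mult_ac flip: ennreal_mult')
    moreover have "\<eta> * \<eta> ^ (DIM('a) - 1) = \<eta> powr real DIM('a)"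
      using \<eta> by (simp add: powr_realpow flip: power_Suc)
    ultimately show ?thesis using \<eta> unfolding U_def \<eta>_def[symmetric]
      by (intro exI[of _ "\<eta> / 2"]) simp
  qed
  then show ?thesis unfolding separation_rate_def using b c \<kappa>
    by (intro exI[of _ "b * c * \<kappa> ^ (DIM('a) - 1) / 2"] conjI exI[of _ 1]) auto
qed

section \<open>Exponent 1 for polytopes\<close>

lemma outer_normal_imp_frontier:
  assumes "y \<in> K" "outer_unit_normal K y u"
  shows "y \<in> frontier K"
proof -
  have "y \<notin> interior K"
  proof
    assume "y \<in> interior K"
    then obtain e where e: "e > 0" "cball y e \<subseteq> K" by (auto simp: mem_interior_cball)
    have u: "norm u = 1" "\<And>k. k \<in> K \<Longrightarrow> (k - y) \<bullet> u \<le> 0"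
      using assms by (auto simp: outer_unit_normal_def)
    have "y + e *\<^sub>R u \<in> K" using e u by (auto simp: dist_norm)
    from u(2)[OF this] show False using e u by (simp add: dot_square_norm)
  qed
  then show ?thesis using assms closed_K by (simp add: frontier_def closure_closed)
qed

text \<open>The faces \<open>G h\<close> meeting the shadow cover it. If all had Hausdorff measure
  zero, the cones over them would be null, contradicting the volume of the cone over the shadow. So
  some face whose normal is an atom of \<phi> meets the shadow; its mass is at least \<gamma>, and
  the margin \<rho> is proportional to the distance.\<close>

lemma separation_rate_polytope:
  assumes \<phi>: "prob_space \<phi>" "sets \<phi> = sets sphere_borel"
    and b: "b > 0" "setwise_ge \<phi> b (surface_area_measure K)"
    and "polytope K"
  shows "separation_rate K \<phi> 1"
proof -
  interpret \<phi>: prob_space \<phi> by fact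
  have "polyhedron K" using assms by (simp add: polytope_imp_polyhedron)
  then obtain F where F: "finite F" "K = \<Inter>F" "\<forall>h\<in>F. \<exists>a b. a \<noteq> 0 \<and> h = {x. a \<bullet> x \<le> b}"
    unfolding polyhedron_def by blast
  obtain a \<beta> where ab: "\<And>h. h \<in> F \<Longrightarrow> a h \<noteq> 0" "\<And>h. h \<in> F \<Longrightarrow> h = {x. a h \<bullet> x \<le> \<beta> h}"
    using F(3) by metis
  define n where "n h = (1 / norm (a h)) *\<^sub>R a h" for h
  \<comment> \<open>Some of these faces may be empty or of lower dimension; those with nonzero
    Hausdorff measure are singled out through \<open>H_G\<close>.\<close>
  define G where "G h = {y \<in> K. a h \<bullet> y = \<beta> h}" for h
  have sets_n: "{n h} \<in> sets \<phi>" if "h \<in> F" for h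
    using ab(1)[OF that] unfolding \<phi> by (auto simp: sets_restrict_space_iff n_def)
  have normal: "outer_unit_normal K y (n h)" if "h \<in> F" "y \<in> G h" for h y
  proof -
    have "a h \<bullet> k \<le> \<beta> h" if "k \<in> K" for k using that F(2) ab(2)[OF \<open>h \<in> F\<close>] \<open>h \<in> F\<close> by blast
    then show ?thesis unfolding outer_unit_normal_def using ab(1)[OF that(1)] that(2)
      by (auto simp: n_def G_def inner_commute[of _ "a h"] inner_diff_right divide_nonpos_pos)
  qed
  have frontier_G: "\<exists>h\<in>F. y \<in> G h" if y: "y \<in> frontier K" for y
  proof (rule ccontr)
    assume *: "\<not> (\<exists>h\<in>F. y \<in> G h)"
    have yK: "y \<in> K" using y frontier_subset_K by blast
    have "y \<in> (\<Inter>h\<in>F. {x. a h \<bullet> x < \<beta> h})"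
    proof
      fix h assume "h \<in> F"
      then have "a h \<bullet> y \<le> \<beta> h" "a h \<bullet> y \<noteq> \<beta> h" using yK F(2) ab(2) * by (auto simp: G_def)
      then show "y \<in> {x. a h \<bullet> x < \<beta> h}" by simp
    qed
    moreover have "open (\<Inter>h\<in>F. {x. a h \<bullet> x < \<beta> h})"
      using F(1) by (intro open_INT) (auto intro: open_halfspace_lt)
    moreover have "(\<Inter>h\<in>F. {x. a h \<bullet> x < \<beta> h}) \<subseteq> K"
    proof
      fix w assume w: "w \<in> (\<Inter>h\<in>F. {x. a h \<bullet> x < \<beta> h})"
      have "w \<in> h" if h: "h \<in> F" for h
        by (subst ab(2)[OF h]) (use w h in \<open>auto intro: less_imp_le\<close>)
      then show "w \<in> K" unfolding F(2) by blast
    qed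
    ultimately have "y \<in> interior K" by (meson interiorI)
    then show False using y by (simp add: frontier_def)
  qed
  have H_G: "0 < measure \<phi> {n h}" if h: "h \<in> F" "hausdorff_measure (DIM('a) - 1) (G h) \<noteq> 0" for h
  proof -
    have "G h \<subseteq> {y \<in> frontier K. \<exists>u\<in>{n h}. outer_unit_normal K y u}"
      using normal[OF h(1)] outer_normal_imp_frontier by (auto simp: G_def)
    then have "hausdorff_measure (DIM('a) - 1) (G h) \<le> surface_area_measure K {n h}"
      unfolding surface_area_measure_def by (rule hausdorff_measure_mono)
    then have "0 < ennreal b * surface_area_measure K {n h}"
      using h(2) b(1) by (auto simp: ennreal_zero_less_mult_iff zero_less_iff_neq_zero)
    also have "\<dots> \<le> emeasure \<phi> {n h}"
      using b(2) sets_n[OF h(1)] by (auto simp: setwise_ge_def)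
    finally show ?thesis by (simp add: \<phi>.emeasure_eq_measure)
  qed
  define P where "P = {h \<in> F. 0 < measure \<phi> {n h}}"
  \<comment> \<open>Inserting 1 makes the set nonempty even if \<open>P\<close> is empty; since
    \<open>P\<close> is finite, the minimum is positive.\<close>
  define \<gamma> where "\<gamma> = Min (insert 1 ((\<lambda>h. measure \<phi> {n h}) ` P))"
  have finP: "finite P" using F(1) by (simp add: P_def)
  have \<gamma>: "0 < \<gamma>" "\<And>h. h \<in> P \<Longrightarrow> \<gamma> \<le> measure \<phi> {n h}"
    using finP by (auto simp: \<gamma>_def P_def)
  from hausdorff_measure_ge_cone_volume[OF dim, of D] obtain c\<^sub>1 where c1: "c\<^sub>1 > 0"
    and H: "\<forall>(z :: 'a) Y T. Y \<subseteq> cball z D \<longrightarrow> T \<in> sets borel \<longrightarrow> T \<subseteq> cone_over z Y \<longrightarrow>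
      ennreal c\<^sub>1 * emeasure lborel T \<le> hausdorff_measure (DIM('a) - 1) Y"
    by (elim exE conjE)
  from cone_over_shadow_volume_ge[of "D + 1"] obtain c\<^sub>2 where c2: "c\<^sub>2 > 0"
    and vol: "\<forall>q\<^sub>0 \<rho>. 0 < \<rho> \<longrightarrow> \<rho> \<le> 1 \<longrightarrow> dist z q\<^sub>0 \<le> D + 1 \<longrightarrow> ball q\<^sub>0 \<rho> \<inter> K = {} \<longrightarrow>
    (\<exists>T. open T \<and> T \<subseteq> cone_over z (shadow K z q\<^sub>0 \<rho>) \<and>
      ennreal (c\<^sub>2 * \<rho> ^ (DIM('a) - 1)) \<le> emeasure lborel T)"
    by (elim exE conjE)
  define \<kappa> where "\<kappa> = r / (4 * (D + 2))"
  have \<kappa>: "\<kappa> > 0" using r D_pos by (simp add: \<kappa>_def)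
  have "\<exists>a>0. ennreal (\<kappa> * \<gamma> * infdist x K powr 1)
      \<le> ennreal a * emeasure \<phi> (separating_directions K x a)"
    if x: "0 < infdist x K" "infdist x K \<le> 1" for x
  proof -
    define \<rho> where "\<rho> = r / (4 * (D + 2)) * infdist x K"
    note S = shadow_normal_separates[OF x \<rho>_def]
    define F' where "F' = {h \<in> F. G h \<inter> shadow K z x \<rho> \<noteq> {}}"
    have F': "finite F'" "F' \<subseteq> F" using F(1) by (auto simp: F'_def)
    have meas: "cone_over z (G h) \<in> sets borel" for h
    proof -
      have "G h = K \<inter> {y. a h \<bullet> y = \<beta> h}" by (auto simp: G_def)
      then have "compact (G h)" using K(1) closed_hyperplane compact_Int_closed by metis
      then show ?thesis using compact_cone_over compact_imp_closed borel_closed by auto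
    qed
    have "\<exists>h\<in>F'. h \<in> P"
    proof (rule ccontr)
      assume "\<not> (\<exists>h\<in>F'. h \<in> P)"
      then have H0: "hausdorff_measure (DIM('a) - 1) (G h) = 0" if "h \<in> F'" for h
        using that H_G F'(2) by (auto simp: P_def)
      have null: "emeasure lborel (cone_over z (G h)) = 0" if "h \<in> F'" for h
      proof -
        have "G h \<subseteq> cball z D" using D by (auto simp: G_def)
        \<comment> \<open>The cone over the compact face is itself Borel and serves as the set
          \<open>T\<close> in \<open>H\<close>. Null cones then replace null faces, so that only
          subadditivity of Lebesgue measure is used.\<close>
        then have "ennreal c\<^sub>1 * emeasure lborel (cone_over z (G h)) \<le> 0"
          using H[rule_format, OF _ meas order_refl] H0[OF that] by metis
        then show ?thesis using c1 by simp
      qed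
      obtain T where T: "open T" "T \<subseteq> cone_over z (shadow K z x \<rho>)"
        "ennreal (c\<^sub>2 * \<rho> ^ (DIM('a) - 1)) \<le> emeasure lborel T"
        using vol[rule_format, OF S(1-4)] by (elim exE conjE)
      have "shadow K z x \<rho> \<subseteq> (\<Union>h\<in>F'. G h)"
        using frontier_G unfolding F'_def shadow_def by blast
      from order_trans[OF T(2) cone_over_mono[OF this]]
      have "T \<subseteq> (\<Union>h\<in>F'. cone_over z (G h))" unfolding cone_over_UN .
      then have "emeasure lborel T \<le> emeasure lborel (\<Union>h\<in>F'. cone_over z (G h))"
        using F' meas by (intro emeasure_mono) auto
      also have "\<dots> \<le> (\<Sum>h\<in>F'. emeasure lborel (cone_over z (G h)))"
        using F' meas by (intro emeasure_subadditive_finite) auto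
      also have "\<dots> = 0" using null by simp
      finally have "ennreal (c\<^sub>2 * \<rho> ^ (DIM('a) - 1)) = 0" using T(3) by simp
      then show False
        using mult_pos_pos[OF c2 zero_less_power[OF S(1), of "DIM('a) - 1"]] by (metis ennreal_eq_0_iff not_le)
    qed
    then obtain h y where h: "h \<in> P" "h \<in> F" "y \<in> G h" "y \<in> shadow K z x \<rho>"
      by (auto simp: F'_def)
    have "n h \<in> separating_directions K x \<rho>" by (intro S(5)[OF h(4)] normal h)
    then have "measure \<phi> {n h} \<le> measure \<phi> (separating_directions K x \<rho>)"
      using sets_separating_directions \<phi> by (intro \<phi>.finite_measure_mono) auto
    then have "\<gamma> \<le> measure \<phi> (separating_directions K x \<rho>)" using \<gamma>(2)[OF h(1)] by linarith
    then have "ennreal \<rho> * ennreal \<gamma> \<le> ennreal \<rho> * emeasure \<phi> (separating_directions K x \<rho>)"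
      by (intro mult_left_mono) (auto simp: \<phi>.emeasure_eq_measure)
    then show ?thesis using S(1) x \<gamma>(1)
      by (intro exI[of _ \<rho>]) (simp add: \<rho>_def \<kappa>_def mult_ac flip: ennreal_mult')
  qed
  then show ?thesis unfolding separation_rate_def using \<kappa> \<gamma>(1)
    by (intro exI[of _ "\<kappa> * \<gamma>"] conjI exI[of _ 1]) auto
qed

section \<open>Exponent (d + 1) / 2 when a ball slides freely\<close>

text \<open>Equality in Cauchy-Schwarz: the point c + s u of the ball lies below the supporting
  hyperplane at \<open>y\<close>, so (y - c) . u >= s, while y - c has norm at most s.\<close>

lemma inscribed_ball_contact:
  assumes "cball c s \<subseteq> K" "0 < s" "y \<in> cball c s" "outer_unit_normal K y u"
  shows "y = c + s *\<^sub>R u"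
proof -
  have u: "norm u = 1" "\<And>k. k \<in> K \<Longrightarrow> (k - y) \<bullet> u \<le> 0"
    using assms by (auto simp: outer_unit_normal_def)
  then have uu: "u \<bullet> u = 1" by (simp add: dot_square_norm)
  have "c + s *\<^sub>R u \<in> K" using assms u by (auto simp: dist_norm)
  then have "s \<le> (y - c) \<bullet> u" using u(2)[of "c + s *\<^sub>R u"] uu by (simp add: inner_diff_left inner_add_left)
  then have "s * s \<le> s * ((y - c) \<bullet> u)" using assms(2) by (intro mult_left_mono) auto
  moreover have "norm (y - c) \<le> s" using assms(3) by (simp add: dist_norm norm_minus_commute)
  then have "(y - c) \<bullet> (y - c) \<le> s * s"
    using mult_mono[of "norm (y - c)" s "norm (y - c)" s] assms(2)
    by (simp add: dot_square_norm power2_eq_square)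
  moreover have "(y - c - s *\<^sub>R u) \<bullet> (y - c - s *\<^sub>R u)
      = (y - c) \<bullet> (y - c) - 2 * (s * ((y - c) \<bullet> u)) + s * s * (u \<bullet> u)"
    by (simp add: inner_diff_left inner_diff_right inner_commute algebra_simps)
  ultimately have "(y - c - s *\<^sub>R u) \<bullet> (y - c - s *\<^sub>R u) \<le> 0" using uu by simp
  then have "y - c - s *\<^sub>R u = 0" by (metis inner_eq_zero_iff inner_ge_zero order_antisym)
  then show ?thesis by (simp add: algebra_simps)
qed

text \<open>The point \<open>w\<close>, a fraction \<tau> short of \<open>q\<close> on the segment
  from \<open>z\<close>, still lies in \<open>K\<close>. The boundary is thus met in the last
  fraction \<tau> of the segment, within \<tau> (D + 2) of \<open>q\<close>.\<close>

lemma shadow_near_boundary_point: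
  assumes "p \<in> K" "0 < \<rho>" "2 * \<rho> \<le> r" "\<rho> \<le> 1" "dist p q\<^sub>0 \<le> \<rho>"
    and "y \<in> shadow K z q\<^sub>0 \<rho>"
  shows "dist p y \<le> (2 + 2 * (D + 2) / r) * \<rho>"
proof -
  obtain q where q: "dist q\<^sub>0 q < \<rho>" "y \<in> closed_segment z q" and y: "y \<in> frontier K"
    using assms by (auto simp: shadow_def)
  obtain s where s: "0 \<le> s" "s \<le> 1" "y = z + s *\<^sub>R (q - z)" using q(2) by (rule in_closed_segmentE)
  have pq: "dist p q \<le> 2 * \<rho>" using q(1) assms(5) dist_triangle[of p q q\<^sub>0] by linarith
  \<comment> \<open>With this value the displacement (q - p) (1 - \<tau>) / \<tau> has norm at most
    \<open>r\<close>, which makes \<open>w\<close> a convex combination of \<open>p\<close> and a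
    point of the inner ball.\<close>
  define \<tau> where "\<tau> = 2 * \<rho> / r"
  have \<tau>: "0 < \<tau>" "\<tau> \<le> 1" using assms r by (auto simp: \<tau>_def)
  define w where "w = z + (1 - \<tau>) *\<^sub>R (q - z)"
  have "\<tau> *\<^sub>R (z + ((1 - \<tau>) / \<tau>) *\<^sub>R (q - p)) = \<tau> *\<^sub>R z + (1 - \<tau>) *\<^sub>R (q - p)"
    using \<tau> by (simp add: scaleR_add_right)
  then have "w = (1 - \<tau>) *\<^sub>R p + \<tau> *\<^sub>R (z + ((1 - \<tau>) / \<tau>) *\<^sub>R (q - p))"
    by (simp add: w_def algebra_simps)
  moreover have "z + ((1 - \<tau>) / \<tau>) *\<^sub>R (q - p) \<in> K"
  proof -
    have "(1 - \<tau>) / \<tau> * norm (q - p) \<le> 1 / \<tau> * (2 * \<rho>)"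
      using \<tau> pq by (intro mult_mono divide_right_mono) (auto simp: dist_norm norm_minus_commute)
    also have "\<dots> = r" using assms(2) r by (simp add: \<tau>_def)
    finally show ?thesis using r \<tau> by (auto simp: dist_norm)
  qed
  ultimately have w: "w \<in> K" using convexD_alt[OF K(2) assms(1), of _ \<tau>] \<tau> by auto
  have "1 - \<tau> \<le> s"
  proof (rule ccontr)
    assume "\<not> 1 - \<tau> \<le> s"
    then have less: "s < 1 - \<tau>" by simp
    \<comment> \<open>A boundary point strictly before \<open>w\<close> would be a contraction of
      \<open>w\<close> towards the interior point \<open>z\<close>, hence interior.\<close>
    define e where "e = 1 - s / (1 - \<tau>)"
    have "0 < e" "e \<le> 1" using less s by (auto simp: e_def field_simps)
    then have "w - e *\<^sub>R (w - z) \<in> interior K"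
      by (intro mem_interior_convex_shrink K z_interior w)
    moreover have "w - e *\<^sub>R (w - z) = z + (1 - e) *\<^sub>R (w - z)" by (simp add: algebra_simps)
    moreover have "\<dots> = y" using less s by (simp add: e_def w_def)
    ultimately show False using y by (simp add: frontier_def)
  qed
  then have "(1 - s) * dist z q \<le> \<tau> * (D + 2)"
    using assms pq D dist_triangle[of z q p] \<tau> by (intro mult_mono) (auto simp: subset_eq)
  moreover have "q - y = (1 - s) *\<^sub>R (q - z)" using s by (simp add: algebra_simps)
  then have "dist q y = (1 - s) * dist z q"
    using s unfolding dist_norm by (simp add: norm_minus_commute)
  ultimately have "dist p y \<le> 2 * \<rho> + \<tau> * (D + 2)" using pq dist_triangle[of p y q] by linarith
  also have "\<dots> = (2 + 2 * (D + 2) / r) * \<rho>" by (simp add: \<tau>_def algebra_simps add_divide_distrib)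
  finally show ?thesis .
qed

text \<open>Balls of radius \<open>s\<close> touching from inside at \<open>y\<close> and \<open>p\<close> make the normals at \<open>y\<close> and \<open>p\<close> differ
  by \<open>O(dist p y)\<close>, so a normal at distance \<open>O(sqrt \<eta>)\<close> from \<open>p\<close> still separates
  \<open>p + \<eta> *\<^sub>R v\<close>.\<close>

lemma smooth_normal_separates:
  assumes slide: "slides_freely_inside (cball c s) K" "0 < s"
    and p: "p \<in> K" "outer_unit_normal K p v"
    and y: "y \<in> frontier K" "outer_unit_normal K y u"
    and \<eta>: "0 \<le> \<eta>" and near: "dist p y \<le> s" "(dist p y)\<^sup>2 \<le> s * \<eta> / 4"
  shows "u \<in> separating_directions K (p + \<eta> *\<^sub>R v) (\<eta> / 4)"
proof -
  define \<delta> where "\<delta> = dist p y"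
  have v: "norm v = 1" "\<And>k. k \<in> K \<Longrightarrow> (k - p) \<bullet> v \<le> 0" and u: "norm u = 1" "\<And>k. k \<in> K \<Longrightarrow> (k - y) \<bullet> u \<le> 0"
    using p y by (auto simp: outer_unit_normal_def)
  have vv: "v \<bullet> v = 1" "u \<bullet> u = 1" using u v by (simp_all add: dot_square_norm)
  have yK: "y \<in> K" using y frontier_subset_K by blast
  obtain c\<^sub>y where cy: "cball c\<^sub>y s \<subseteq> K" "y \<in> cball c\<^sub>y s" using slides_freely_cballE[OF slide(1) yK] .
  obtain c\<^sub>p where cp: "cball c\<^sub>p s \<subseteq> K" "p \<in> cball c\<^sub>p s" using slides_freely_cballE[OF slide(1) p(1)] .
  have ey: "y = c\<^sub>y + s *\<^sub>R u" by (rule inscribed_ball_contact[OF cy(1) slide(2) cy(2) y(2)])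
  have ep: "p = c\<^sub>p + s *\<^sub>R v" by (rule inscribed_ball_contact[OF cp(1) slide(2) cp(2) p(2)])
  have "c\<^sub>y + s *\<^sub>R v \<in> K" using cy slide(2) v by (auto simp: dist_norm)
  then have "(c\<^sub>y + s *\<^sub>R v - p) \<bullet> v \<le> 0" by (rule v)
  \<comment> \<open>The ball touching at \<open>y\<close> contains
    \<open>c\<^sub>y + s *\<^sub>R v\<close>, which cannot rise above the supporting hyperplane at
    \<open>p\<close>.\<close>
  then have 1: "s * (1 - u \<bullet> v) \<le> (p - y) \<bullet> v"
    using vv by (simp add: ey inner_diff_left inner_add_left algebra_simps)
  \<comment> \<open>In the other direction, the boundary point \<open>y\<close> avoids the open ball
    touching at \<open>p\<close>, so \<open>y\<close> lies at most of order \<delta> squared below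
    the supporting hyperplane at \<open>p\<close>.\<close>
  have "y \<notin> ball c\<^sub>p s"
    using y(1) interior_mono[OF cp(1)] by (auto simp: frontier_def interior_cball)
  then have "s \<le> norm (y - c\<^sub>p)" by (simp add: dist_norm norm_minus_commute)
  then have "s\<^sup>2 \<le> (norm (y - c\<^sub>p))\<^sup>2" using slide(2) by (intro power_mono) auto
  also have "\<dots> = (y - p + s *\<^sub>R v) \<bullet> (y - p + s *\<^sub>R v)" by (simp add: ep dot_square_norm)
  also have "\<dots> = (y - p) \<bullet> (y - p) + 2 * s * ((y - p) \<bullet> v) + s\<^sup>2 * (v \<bullet> v)"
    by (simp add: inner_add_left inner_add_right inner_commute power2_eq_square)
  also have "\<dots> = \<delta>\<^sup>2 - 2 * s * ((p - y) \<bullet> v) + s\<^sup>2"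
    unfolding vv \<delta>_def dist_commute[of p y] dist_norm
    by (simp add: dot_square_norm inner_diff_left norm_minus_commute[of p y] algebra_simps)
  finally have 2: "2 * s * ((p - y) \<bullet> v) \<le> \<delta>\<^sup>2" by simp
  have "2 * s * (s * (1 - u \<bullet> v)) \<le> 2 * s * ((p - y) \<bullet> v)"
    using 1 slide(2) by (intro mult_left_mono) auto
  then have 3: "s\<^sup>2 * (2 - 2 * (u \<bullet> v)) \<le> \<delta>\<^sup>2" using 2 by (simp add: power2_eq_square algebra_simps)
  have "(norm (u - v))\<^sup>2 = 2 - 2 * (u \<bullet> v)"
    using vv by (simp add: power2_norm_eq_inner inner_diff_left inner_diff_right inner_commute)
  then have "(s * norm (u - v))\<^sup>2 \<le> \<delta>\<^sup>2" using 3 by (simp add: power_mult_distrib)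
  then have 4: "s * norm (u - v) \<le> \<delta>" by (rule power2_le_imp_le) (simp add: \<delta>_def)
  have "\<delta>\<^sup>2 \<le> s\<^sup>2" using near(1) by (intro power_mono) (auto simp: \<delta>_def)
  then have "s\<^sup>2 * (2 - 2 * (u \<bullet> v)) \<le> s\<^sup>2 * 1" using 3 by simp
  then have "2 - 2 * (u \<bullet> v) \<le> 1" by (rule mult_left_le_imp_le) (use slide(2) in simp)
  \<comment> \<open>Since \<delta> is at most s, the two normals have inner product at least 1 /
    2.\<close>
  then have 5: "\<eta> * (1 / 2) \<le> \<eta> * (u \<bullet> v)" using \<eta> by (intro mult_left_mono) auto
  have "\<bar>(p - y) \<bullet> (u - v)\<bar> \<le> \<delta> * norm (u - v)"
    using Cauchy_Schwarz_ineq2[of "p - y" "u - v"] by (simp add: \<delta>_def dist_norm)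
  then have "s * \<bar>(p - y) \<bullet> (u - v)\<bar> \<le> \<delta> * (s * norm (u - v))"
    using mult_left_mono[of _ _ s] slide(2) by (simp add: mult.left_commute)
  also have "\<dots> \<le> \<delta> * \<delta>" using 4 by (intro mult_left_mono) (auto simp: \<delta>_def)
  also have "\<dots> \<le> s * (\<eta> / 4)" using near(2) by (simp add: \<delta>_def power2_eq_square)
  finally have 6: "\<bar>(p - y) \<bullet> (u - v)\<bar> \<le> \<eta> / 4" using slide(2) by simp
  have 7: "(p - y) \<bullet> v \<ge> 0" using v(2)[OF yK] by (simp add: inner_diff_left)
  show ?thesis
    unfolding separating_directions_def
  proof (intro CollectI conjI ballI)
    fix k assume "k \<in> K"
    then have "(k - y) \<bullet> u \<le> 0" by (rule u)
    \<comment> \<open>The first term is at least \<eta> / 2, the second is nonnegative, the third is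
      at least -\<eta> / 4 by \<open>6\<close>, and the subtracted last term is nonpositive.\<close>
    moreover have "(p + \<eta> *\<^sub>R v - k) \<bullet> u = \<eta> * (u \<bullet> v) + (p - y) \<bullet> v + (p - y) \<bullet> (u - v) - (k - y) \<bullet> u"
      by (simp add: inner_diff_left inner_diff_right inner_add_left inner_commute[of u v])
    ultimately show "\<eta> / 4 \<le> (p + \<eta> *\<^sub>R v - k) \<bullet> u" using 5 6 7 by linarith
  qed (use u in auto)
qed

text \<open>Normals within order sqrt \<eta> of the nearest point \<open>p\<close> still separate
  with margin \<eta> / 4, so the patch may have radius \<rho> of order sqrt \<eta>; this gives
  \<eta> to the power 1 + (d - 1) / 2.\<close>

lemma separation_rate_smooth:
  assumes \<phi>: "sets \<phi> = sets sphere_borel" and b: "b > 0" "setwise_ge \<phi> b (surface_area_measure K)"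
    and slide: "slides_freely_inside (cball c s) K" "0 < s"
  shows "separation_rate K \<phi> ((real DIM('a) + 1) / 2)"
proof -
  from hausdorff_measure_shadow_ge[of "D + 1"] obtain c\<^sub>0 where c: "c\<^sub>0 > 0"
    and H: "\<forall>q\<^sub>0 \<rho>. 0 < \<rho> \<longrightarrow> \<rho> \<le> 1 \<longrightarrow> dist z q\<^sub>0 \<le> D + 1 \<longrightarrow> ball q\<^sub>0 \<rho> \<inter> K = {} \<longrightarrow>
    ennreal (c\<^sub>0 * \<rho> ^ (DIM('a) - 1)) \<le> hausdorff_measure (DIM('a) - 1) (shadow K z q\<^sub>0 \<rho>)"
    by (elim exE conjE)
  define C where "C = 2 + 2 * (D + 2) / r"
  have C: "C > 0" using D_pos r by (auto simp: C_def intro!: add_pos_pos divide_pos_pos)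
  \<comment> \<open>The terms ensure, in order, \<rho> <= 1, 2 \<rho> <= r, C \<rho> <= s and (C
    \<rho>) squared <= s \<eta> / 4, as the two preceding lemmas require.\<close>
  define \<kappa> where "\<kappa> = min (min 1 (r / 2)) (min (s / C) (sqrt s / (2 * C)))"
  have \<kappa>: "0 < \<kappa>" "\<kappa> \<le> 1" "2 * \<kappa> \<le> r" "C * \<kappa> \<le> s" "C * \<kappa> \<le> sqrt s / 2"
  proof -
    have "\<kappa> \<le> s / C" "\<kappa> \<le> sqrt s / (2 * C)" "\<kappa> \<le> r / 2" unfolding \<kappa>_def by linarith+
    then show "C * \<kappa> \<le> s" "C * \<kappa> \<le> sqrt s / 2" "2 * \<kappa> \<le> r" using C by (simp_all add: field_simps)
    have "0 < s / C" "0 < sqrt s / (2 * C)" "0 < r / 2" using C r slide(2) by simp_all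
    then show "0 < \<kappa>" unfolding \<kappa>_def by simp
  qed (simp add: \<kappa>_def)
  have "\<exists>a>0. ennreal (b * c\<^sub>0 * \<kappa> ^ (DIM('a) - 1) / 4 * infdist x K powr ((real DIM('a) + 1) / 2))
      \<le> ennreal a * emeasure \<phi> (separating_directions K x a)"
    if x: "0 < infdist x K" "infdist x K \<le> 1" for x
  proof -
    define \<eta> where "\<eta> = infdist x K"
    have \<eta>: "0 < \<eta>" "\<eta> \<le> 1" using x by (auto simp: \<eta>_def)
    define \<rho> where "\<rho> = \<kappa> * sqrt \<eta>"
    have sq: "0 < sqrt \<eta>" "sqrt \<eta> \<le> 1" using \<eta> by auto
    then have \<rho>: "0 < \<rho>" "\<rho> \<le> \<kappa>" using \<kappa> by (auto simp: \<rho>_def mult_left_le)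
    obtain p v where p: "p \<in> K" "norm v = 1" "x = p + \<eta> *\<^sub>R v" "\<And>k. k \<in> K \<Longrightarrow> (k - p) \<bullet> v \<le> 0"
      using nearest_point[OF closed_K K(2) _ x(1)] z_in_K unfolding \<eta>_def by blast
    have pv: "outer_unit_normal K p v" using p by (auto simp: outer_unit_normal_def)
    define q\<^sub>0 where "q\<^sub>0 = p + \<rho> *\<^sub>R v"
    have pq: "dist p q\<^sub>0 = \<rho>" using p \<rho> by (simp add: q\<^sub>0_def dist_norm)
    have zq: "dist z q\<^sub>0 \<le> D + 1"
      using pq p D \<rho> \<kappa> dist_triangle[of z q\<^sub>0 p] by (auto simp: subset_eq)
    \<comment> \<open>A ball of radius \<rho> around \<open>x\<close> could meet \<open>K\<close>.
      The ball around \<open>q\<^sub>0\<close> lies strictly above the supporting hyperplane at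
      \<open>p\<close>.\<close>
    have disj: "ball q\<^sub>0 \<rho> \<inter> K = {}"
    proof safe
      fix k assume k: "k \<in> ball q\<^sub>0 \<rho>" "k \<in> K"
      have "(q\<^sub>0 - k) \<bullet> v \<le> norm (q\<^sub>0 - k) * norm v" by (rule norm_cauchy_schwarz)
      then have "(q\<^sub>0 - k) \<bullet> v < \<rho>" using k p by (simp add: dist_norm)
      moreover have "(q\<^sub>0 - k) \<bullet> v = \<rho> - (k - p) \<bullet> v"
        using p(2) by (simp add: q\<^sub>0_def inner_diff_left inner_add_left dot_square_norm)
      ultimately show "k \<in> {}" using p(4)[OF k(2)] by linarith
    qed
    define U where "U = separating_directions K x (\<eta> / 4)"
    have "u \<in> U" if y: "y \<in> shadow K z q\<^sub>0 \<rho>" and u: "outer_unit_normal K y u" for y u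
    proof -
      have dy: "dist p y \<le> C * \<rho>"
        unfolding C_def using \<rho> \<kappa> pq y p by (intro shadow_near_boundary_point[of p \<rho> q\<^sub>0]) auto
      have "C * \<rho> \<le> C * \<kappa>" using C \<rho> by (intro mult_left_mono) auto
      then have "dist p y \<le> s" using dy \<kappa>(4) by linarith
      moreover have "C * \<rho> \<le> sqrt s / 2 * sqrt \<eta>"
        using mult_right_mono[OF \<kappa>(5), of "sqrt \<eta>"] sq by (simp add: \<rho>_def mult.assoc)
      then have "(dist p y)\<^sup>2 \<le> (sqrt s / 2 * sqrt \<eta>)\<^sup>2" using dy by (intro power_mono) auto
      then have "(dist p y)\<^sup>2 \<le> s * \<eta> / 4"
        using slide(2) \<eta> by (simp add: power_mult_distrib power_divide)
      moreover have "y \<in> frontier K" using y by (simp add: shadow_def)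
      ultimately show ?thesis
        unfolding U_def p(3) using \<eta> by (intro smooth_normal_separates[OF slide p(1) pv _ u]) auto
    qed
    then have "ennreal (c\<^sub>0 * \<rho> ^ (DIM('a) - 1)) \<le> surface_area_measure K U"
      using H[rule_format, OF \<rho>(1) order_trans[OF \<rho>(2) \<kappa>(2)] zq disj]
        surface_area_measure_ge_shadow[of q\<^sub>0 \<rho> U] order_trans by blast
    then have "ennreal b * ennreal (c\<^sub>0 * \<rho> ^ (DIM('a) - 1)) \<le> ennreal b * surface_area_measure K U"
      by (intro mult_left_mono) auto
    also have "\<dots> \<le> emeasure \<phi> U"
      using b(2) sets_separating_directions \<phi> by (auto simp: setwise_ge_def U_def)
    finally have "ennreal (\<eta> / 4) * (ennreal b * ennreal (c\<^sub>0 * \<rho> ^ (DIM('a) - 1)))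
        \<le> ennreal (\<eta> / 4) * emeasure \<phi> U"
      by (intro mult_left_mono) auto
    moreover have "ennreal (\<eta> / 4) * (ennreal b * ennreal (c\<^sub>0 * \<rho> ^ (DIM('a) - 1)))
        = ennreal (b * c\<^sub>0 * \<kappa> ^ (DIM('a) - 1) / 4 * (\<eta> * sqrt \<eta> ^ (DIM('a) - 1)))"
      using \<eta> b c by (simp add: \<rho>_def power_mult_distrib mult_ac flip: ennreal_mult')
    moreover have "\<eta> * sqrt \<eta> ^ (DIM('a) - 1) = \<eta> powr ((real DIM('a) + 1) / 2)"
    proof -
      have "sqrt \<eta> ^ (DIM('a) - 1) = (\<eta> powr (1 / 2)) powr real (DIM('a) - 1)"
        using \<eta> powr_realpow[OF sq(1), of "DIM('a) - 1"] by (simp only: powr_half_sqrt less_imp_le)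
      also have "\<dots> = \<eta> powr ((real DIM('a) - 1) / 2)"
        by (simp add: powr_powr of_nat_diff)
      finally have "\<eta> * sqrt \<eta> ^ (DIM('a) - 1) = \<eta> powr 1 * \<eta> powr ((real DIM('a) - 1) / 2)"
        using \<eta> by simp
      also have "\<dots> = \<eta> powr ((real DIM('a) + 1) / 2)"
        unfolding powr_add[symmetric] by (simp add: field_simps)
      finally show ?thesis .
    qed
    ultimately show ?thesis using \<eta> unfolding U_def \<eta>_def[symmetric]
      by (intro exI[of _ "\<eta> / 4"]) simp
  qed
  then show ?thesis unfolding separation_rate_def using b c \<kappa>
    by (intro exI[of _ "b * c\<^sub>0 * \<kappa> ^ (DIM('a) - 1) / 4"] conjI exI[of _ 1]) auto
qed

end

section \<open>Almost sure rates\<close>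

text \<open>Rounding every coordinate down to a multiple of 1 / n changes each by at most 1 / n, so
  the error is at most d / n already in the sum norm.\<close>

lemma finite_net:
  fixes R n :: nat
  assumes "1 \<le> n"
  shows "\<exists>G :: 'a::euclidean_space set. finite G \<and> real (card G) \<le> (real (2 * R + 1) * real n) ^ DIM('a) \<and>
    (\<forall>x. norm x \<le> real R \<longrightarrow> (\<exists>g\<in>G. dist g x \<le> real DIM('a) / real n))"
proof -
  define I where "I = {- int (R * n)..int (R * n)}"
  define f where "f k = (\<Sum>b\<in>Basis. (of_int (k b) / real n) *\<^sub>R b)" for k :: "'a \<Rightarrow> int"
  define G where "G = f ` (Basis \<rightarrow>\<^sub>E I)"
  have fin: "finite (Basis \<rightarrow>\<^sub>E I :: ('a \<Rightarrow> int) set)" by (intro finite_PiE) (auto simp: I_def)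
  have "card G \<le> card (Basis \<rightarrow>\<^sub>E I :: ('a \<Rightarrow> int) set)" unfolding G_def by (rule card_image_le[OF fin])
  also have "\<dots> = (2 * (R * n) + 1) ^ DIM('a)"
  proof -
    have "card I = 2 * (R * n) + 1" unfolding I_def card_atLeastAtMost_int by linarith
    then show ?thesis by (simp add: card_PiE)
  qed
  also have "\<dots> \<le> ((2 * R + 1) * n) ^ DIM('a)"
    using assms by (intro power_mono) (auto simp: algebra_simps)
  finally have "real (card G) \<le> real (((2 * R + 1) * n) ^ DIM('a))" by (rule of_nat_mono)
  then have "real (card G) \<le> (real (2 * R + 1) * real n) ^ DIM('a)" by (simp only: of_nat_power of_nat_mult)
  moreover have "\<exists>g\<in>G. dist g x \<le> real DIM('a) / real n" if x: "norm x \<le> real R" for x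
  proof -
    define k where "k = restrict (\<lambda>b. \<lfloor>real n * (x \<bullet> b)\<rfloor>) (Basis :: 'a set)"
    have "k b \<in> I" if b: "b \<in> Basis" for b
    proof -
      have "\<bar>x \<bullet> b\<bar> \<le> real R" using Basis_le_norm[OF b, of x] x by linarith
      then have "real n * \<bar>x \<bullet> b\<bar> \<le> real n * real R" by (intro mult_left_mono) auto
      then have "\<bar>real n * (x \<bullet> b)\<bar> \<le> real (R * n)" by (simp add: abs_mult mult.commute)
      then have "- real (R * n) \<le> real n * (x \<bullet> b)" "real n * (x \<bullet> b) \<le> real (R * n)" by linarith+
      then have "- int (R * n) \<le> \<lfloor>real n * (x \<bullet> b)\<rfloor>" "\<lfloor>real n * (x \<bullet> b)\<rfloor> \<le> int (R * n)"
        by linarith+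
      then show ?thesis using b by (simp add: k_def I_def)
    qed
    then have "f k \<in> G" unfolding G_def by (intro imageI) (auto simp: k_def PiE_iff extensional_def)
    moreover have "\<bar>(f k - x) \<bullet> b\<bar> \<le> 1 / real n" if b: "b \<in> Basis" for b
    proof -
      have "(f k - x) \<bullet> b = of_int \<lfloor>real n * (x \<bullet> b)\<rfloor> / real n - x \<bullet> b"
        using b by (simp add: f_def inner_diff_left inner_sum_left inner_Basis if_distrib cong: if_cong)
          (simp add: k_def)
      also have "\<dots> = (of_int \<lfloor>real n * (x \<bullet> b)\<rfloor> - real n * (x \<bullet> b)) / real n"
        using assms by (simp add: field_simps)
      finally have "\<bar>(f k - x) \<bullet> b\<bar> = \<bar>of_int \<lfloor>real n * (x \<bullet> b)\<rfloor> - real n * (x \<bullet> b)\<bar> / real n"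
        by simp
      also have "\<bar>of_int \<lfloor>real n * (x \<bullet> b)\<rfloor> - real n * (x \<bullet> b)\<bar> \<le> 1" by linarith
      finally show ?thesis by (simp add: divide_right_mono)
    qed
    then have "(\<Sum>b\<in>Basis. \<bar>(f k - x) \<bullet> b\<bar>) \<le> (\<Sum>b\<in>(Basis :: 'a set). 1 / real n)" by (intro sum_mono)
    then have "dist (f k) x \<le> real DIM('a) / real n"
      using norm_le_l1[of "f k - x"] by (simp add: dist_norm)
    ultimately show ?thesis by blast
  qed
  ultimately show ?thesis using fin by (intro exI[of _ G]) (auto simp: G_def)
qed

context nested_balls
begin

text \<open>If some \<open>y\<close> of the cell has distance more than \<open>\<epsilon>\<close> from \<open>K\<close>, then the cell, being convex and
  containing \<open>K\<close>, contains a ball of radius \<open>O(\<epsilon>)\<close> that still has distance at least \<open>\<epsilon> / 2\<close>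
  from \<open>K\<close>, and hence a point of the net.\<close>

lemma hausdorff_distance_K_cell_le:
  assumes X: "X \<subseteq> hyperplanes" and \<epsilon>: "0 < \<epsilon>" "\<epsilon> \<le> 1"
    and net: "\<And>w. dist z w \<le> D + 1 \<Longrightarrow> \<exists>g\<in>G. dist g w \<le> r / (4 * (D + 1)) * \<epsilon>"
    and excl: "\<And>g. g \<in> G \<Longrightarrow> \<epsilon> / 2 \<le> infdist g K \<Longrightarrow> infdist g K \<le> 2 * \<epsilon> \<Longrightarrow> g \<notin> K_cell K X"
  shows "hausdorff_distance K (K_cell K X) \<le> \<epsilon>"
proof -
  let ?Z = "K_cell K X"
  have ne: "K \<noteq> {}" using z_in_K by blast
  note Z = K_cell_convex_superset[OF K(2) ne X]
  have "infdist y K \<le> \<epsilon>" if y: "y \<in> ?Z" for y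
  proof (rule ccontr)
    assume "\<not> infdist y K \<le> \<epsilon>"
    \<comment> \<open>The intermediate value theorem replaces \<open>y\<close>, which may be far
      away, by a point of the cell at distance exactly \<epsilon>, where the net is
      available.\<close>
    define h where "h s = infdist (z + s *\<^sub>R (y - z)) K" for s :: real
    have "\<exists>s\<ge>0. s \<le> 1 \<and> h s = \<epsilon>"
    proof (rule IVT')
      show "h 0 \<le> \<epsilon>" using z_in_K \<epsilon> by (simp add: h_def)
      show "\<epsilon> \<le> h 1" using \<open>\<not> infdist y K \<le> \<epsilon>\<close> by (simp add: h_def)
      show "continuous_on {0..1} h" unfolding h_def by (intro continuous_intros)
    qed simp
    then obtain s where s: "0 \<le> s" "s \<le> 1" "h s = \<epsilon>" by blast
    define w where "w = z + s *\<^sub>R (y - z)"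
    have w: "infdist w K = \<epsilon>" using s by (simp add: w_def h_def)
    have "w = (1 - s) *\<^sub>R z + s *\<^sub>R y" by (simp add: w_def algebra_simps)
    then have wZ: "w \<in> ?Z" using convexD_alt[OF Z(1) _ y s(1,2)] Z(2) z_in_K by blast
    have zw: "dist z w \<le> D + 1" using infdist_imp_dist_le[of w] w \<epsilon> by linarith
    \<comment> \<open>Moving \<open>w\<close> by the fraction \<tau> towards \<open>z\<close> costs
      at most \<epsilon> / 4 and gains a ball of radius r \<tau> inside the cell; r \<tau> is
      exactly the mesh of the net.\<close>
    define \<tau> where "\<tau> = \<epsilon> / (4 * (D + 1))"
    have \<tau>: "0 < \<tau>" "\<tau> \<le> 1" using \<epsilon> D_pos by (auto simp: \<tau>_def field_simps)
    define m where "m = (1 - \<tau>) *\<^sub>R w + \<tau> *\<^sub>R z"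
    have "m - w = \<tau> *\<^sub>R (z - w)" by (simp add: m_def algebra_simps)
    then have "dist m w = \<tau> * dist z w" using \<tau> by (simp add: dist_norm)
    also have "\<dots> \<le> \<tau> * (D + 1)" using zw \<tau> by (intro mult_left_mono) auto
    also have "\<dots> = \<epsilon> / 4" using D_pos by (simp add: \<tau>_def field_simps)
    finally have mw: "dist m w \<le> \<epsilon> / 4" .
    have "m - z = (1 - \<tau>) *\<^sub>R (w - z)" by (simp add: m_def algebra_simps)
    then have "dist z m = (1 - \<tau>) * dist z w" using \<tau> by (simp add: dist_norm norm_minus_commute[of z])
    also have "\<dots> \<le> dist z w" using \<tau> by (simp add: mult_left_le_one_le)
    finally obtain g where g: "g \<in> G" "dist g m \<le> r / (4 * (D + 1)) * \<epsilon>" using net[of m] zw by auto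
    have gm: "dist g m \<le> r * \<tau>" using g(2) by (simp add: \<tau>_def)
    have "r * \<tau> \<le> (D + 1) * \<tau>" using r_le_D \<tau> by (intro mult_right_mono) auto
    also have "\<dots> = \<epsilon> / 4" using D_pos by (simp add: \<tau>_def field_simps)
    finally have "dist g m \<le> \<epsilon> / 4" using gm by linarith
    then have gw: "dist g w \<le> \<epsilon> / 2" using mw dist_triangle[of g w m] by linarith
    have "g \<in> ?Z"
    proof -
      have "norm ((1 / \<tau>) *\<^sub>R (g - m)) = dist g m / \<tau>" using \<tau> by (simp add: dist_norm)
      also have "\<dots> \<le> r" using gm \<tau> by (simp add: pos_divide_le_eq)
      finally have "z + (1 / \<tau>) *\<^sub>R (g - m) \<in> cball z r"
        unfolding mem_cball dist_norm by (metis add_diff_cancel_left' norm_minus_commute)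
      then have "z + (1 / \<tau>) *\<^sub>R (g - m) \<in> ?Z" using r Z(2) by blast
      from convexD_alt[OF Z(1) wZ this, of \<tau>] \<tau>
      have "(1 - \<tau>) *\<^sub>R w + \<tau> *\<^sub>R (z + (1 / \<tau>) *\<^sub>R (g - m)) \<in> ?Z" by simp
      moreover have "(1 - \<tau>) *\<^sub>R w + \<tau> *\<^sub>R (z + (1 / \<tau>) *\<^sub>R (g - m)) = g"
        using \<tau> by (simp add: scaleR_add_right m_def)
      ultimately show ?thesis by simp
    qed
    moreover have "\<epsilon> / 2 \<le> infdist g K" using infdist_triangle[of w K g] gw w by (simp add: dist_commute)
    moreover have "infdist g K \<le> 2 * \<epsilon>" using infdist_triangle[of g K w] gw w \<epsilon> by simp
    ultimately show False using excl g(1) by blast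
  qed
  \<comment> \<open>The other half of the Hausdorff distance is trivial because the cell contains
    \<open>K\<close>.\<close>
  moreover have "infdist x ?Z \<le> \<epsilon>" if "x \<in> K" for x using that Z(2) \<epsilon> by (simp add: subset_iff)
  moreover have "?Z \<noteq> {}" using Z(2) ne by blast
  ultimately show ?thesis unfolding hausdorff_distance_def
    using ne by (intro max.boundedI cSUP_least)
qed

end

section \<open>Void probabilities and the Borel-Cantelli argument\<close>

text \<open>This is the Poisson law at count 0, with mean t times the intensity of the separating
  hyperplanes, hence at least t s.\<close>

lemma poisson_void_probability_le:
  fixes K :: "'a::euclidean_space set"
  assumes \<phi>: "prob_space \<phi>" "sets \<phi> = sets sphere_borel" "even_measure \<phi>"
    and P: "poisson_process M (prod_topology (top_of_set {0..}) hyperplane_topology)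
      (restrict_space lborel {0..} \<Otimes>\<^sub>M hyperplane_measure \<phi> 1) \<xi>"
    and K: "compact K" "K \<noteq> {}"
    and s: "0 \<le> t" "ennreal s \<le> emeasure (hyperplane_measure \<phi> 1) (separating_hyperplanes K x)"
  shows "{\<omega> \<in> space M. emeasure (\<xi> \<omega>) ({0..t} \<times> separating_hyperplanes K x) = 0} \<in> sets M"
    "measure M {\<omega> \<in> space M. emeasure (\<xi> \<omega>) ({0..t} \<times> separating_hyperplanes K x) = 0} \<le> exp (- t * s)"
proof -
  let ?\<mu> = "restrict_space lborel {0..} \<Otimes>\<^sub>M hyperplane_measure \<phi> 1"
  let ?A = "{0..t} \<times> separating_hyperplanes K x"
  have A: "separating_hyperplanes K x \<in> sets hyperplane_borel"
    using K by (intro openin_imp_sets_hyperplane_borel openin_separating_hyperplanes)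
  note \<mu> = emeasure_time_hyperplane[OF \<phi> s(1) A]
  have "emeasure (hyperplane_measure \<phi> 1) (separating_hyperplanes K x) < \<infinity>"
    using K by (intro hyperplane_measure_separating_finite[OF \<phi>] compact_imp_bounded)
  then have fin: "emeasure ?\<mu> ?A < \<infinity>" by (simp add: \<mu>(2) ennreal_mult_less_top)
  have meas: "(\<lambda>\<omega>. emeasure (\<xi> \<omega>) ?A) \<in> borel_measurable M"
    using P \<mu>(1) unfolding poisson_process_def by blast
  then show "{\<omega> \<in> space M. emeasure (\<xi> \<omega>) ?A = 0} \<in> sets M" by measurable
  have "ennreal (t * s) = ennreal t * ennreal s" using s(1) by (rule ennreal_mult')
  also have "\<dots> \<le> emeasure ?\<mu> ?A" unfolding \<mu>(2) by (intro mult_left_mono s) simp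
  also have "\<dots> = ennreal (measure ?\<mu> ?A)" using fin by (intro emeasure_eq_ennreal_measure) simp
  finally have "t * s \<le> measure ?\<mu> ?A" by simp
  moreover have "measure M {\<omega> \<in> space M. emeasure (\<xi> \<omega>) ?A = of_nat 0}
      = exp (- measure ?\<mu> ?A) * measure ?\<mu> ?A ^ 0 / fact 0"
    using P \<mu>(1) fin unfolding poisson_process_def by blast
  ultimately show "measure M {\<omega> \<in> space M. emeasure (\<xi> \<omega>) ?A = 0} \<le> exp (- t * s)" by simp
qed

text \<open>Positive mass on an open set forces a support point in it, that is, a separating
  hyperplane belonging to the process.\<close>

lemma K_cell_excludes:
  fixes K :: "'a::euclidean_space set"
  assumes \<nu>: "sets \<nu> = sets (restrict_space lborel {0..} \<Otimes>\<^sub>M hyperplane_measure \<phi> 1)"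
    and K: "compact K" "K \<noteq> {}" and "0 \<le> t"
    and ne: "emeasure \<nu> ({0..t} \<times> separating_hyperplanes K x) \<noteq> 0"
  shows "x \<notin> K_cell K (hyperplane_process t \<nu>)"
proof -
  note op = openin_separating_hyperplanes[OF K(1), of x]
  have "emeasure (time_section t \<nu>) (separating_hyperplanes K x) \<noteq> 0"
    using ne emeasure_time_section[OF \<nu> openin_imp_sets_hyperplane_borel[OF op] assms(4)] by simp
  moreover have "sets (time_section t \<nu>) = sets hyperplane_borel" by (simp add: time_section_def)
  ultimately obtain H where "H \<in> separating_hyperplanes K x" "H \<in> hyperplane_process t \<nu>"
    using measure_support_hyperplane_meets[OF _ op] unfolding hyperplane_process_def by blast
  then show ?thesis using separating_hyperplane_excludes[OF K(2)] by blast
qed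

lemma hyperplane_process_subset: "hyperplane_process t \<nu> \<subseteq> hyperplanes"
  by (auto simp: hyperplane_process_def measure_support_def topspace_hyperplane_topology)

text \<open>The net has O(n^d) points and each relevant one fails to be cut off with probability at
  most n^(-d-2), so the failure probabilities are bounded by a multiple of n^(-2) and are
  summable.\<close>

lemma (in nested_balls) K_cell_rate:
  assumes \<phi>: "prob_space \<phi>" "sets \<phi> = sets sphere_borel" "even_measure \<phi>"
    and P: "poisson_process M (prod_topology (top_of_set {0..}) hyperplane_topology)
      (restrict_space lborel {0..} \<Otimes>\<^sub>M hyperplane_measure \<phi> 1) \<xi>"
    and sep: "separation_rate K \<phi> p" and p: "1 \<le> p"
  shows "almost_surely_bigo M
    (\<lambda>n \<omega>. hausdorff_distance K (K_cell K (hyperplane_process (real n) (\<xi> \<omega>))))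
    (\<lambda>n. (ln (real n) / real n) powr (1 / p))"
proof -
  interpret M: prob_space M using P by (simp add: poisson_process_def)
  have ne: "K \<noteq> {}" using z_in_K by blast
  obtain c \<eta>\<^sub>0 where c: "c > 0" "\<eta>\<^sub>0 > 0" and sep': "\<And>x. 0 < infdist x K \<Longrightarrow> infdist x K \<le> \<eta>\<^sub>0 \<Longrightarrow>
     \<exists>a>0. ennreal (c * infdist x K powr p) \<le> ennreal a * emeasure \<phi> (separating_directions K x a)"
    using sep unfolding separation_rate_def by blast
  let ?A = "separating_hyperplanes K"
  have \<Theta>: "ennreal (c * infdist x K powr p) \<le> emeasure (hyperplane_measure \<phi> 1) (?A x)"
    if x: "0 < infdist x K" "infdist x K \<le> \<eta>\<^sub>0" for x
  proof -
    obtain a where "ennreal (c * infdist x K powr p) \<le> ennreal a * emeasure \<phi> (separating_directions K x a)"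
      using sep'[OF x] by blast
    also have "\<dots> \<le> emeasure (hyperplane_measure \<phi> 1) (?A x)"
      using sets_separating_directions[of K x a] \<phi>(2)
      by (intro hyperplane_measure_separating_ge[OF \<phi> K(1) ne]) (auto simp: separating_directions_def)
    finally show ?thesis .
  qed
  define d where "d = DIM('a)"
  define \<kappa> where "\<kappa> = r / (4 * (D + 1))"
  have \<kappa>: "0 < \<kappa>" using r D_pos by (simp add: \<kappa>_def)
  \<comment> \<open>The value 2 gives C / 2 <= (C / 2) powr p, the second term makes the mesh d / n
    at most \<kappa> \<epsilon>, and the third produces the exponent d + 2 in the void
    probability.\<close>
  define C where "C = max 2 (max (real d / \<kappa>) (2 * (real d + 2) / c))"
  have "real d / \<kappa> \<le> C" "2 * (real d + 2) / c \<le> C" by (auto simp: C_def)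
  then have C: "2 \<le> C" "real d \<le> \<kappa> * C" "real d + 2 \<le> c * (C / 2)"
    using \<kappa> c by (auto simp: field_simps C_def)
  define f where "f n = (ln (real n) / real n) powr (1 / p)" for n
  define \<epsilon> where "\<epsilon> n = C * f n" for n
  obtain R :: nat where R: "norm z + D + 1 \<le> real R" using real_arch_simple by blast
  obtain G :: "nat \<Rightarrow> 'a set" where G: "\<And>n. 1 \<le> n \<Longrightarrow> finite (G n)"
    "\<And>n. 1 \<le> n \<Longrightarrow> real (card (G n)) \<le> (real (2 * R + 1) * real n) ^ d"
    "\<And>n x. 1 \<le> n \<Longrightarrow> norm x \<le> real R \<Longrightarrow> \<exists>g\<in>G n. dist g x \<le> real d / real n"
    using finite_net[where 'a='a, of _ R] unfolding d_def by metis
  have "f \<longlonglongrightarrow> 0"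
  proof -
    have "0 < 1 / p" using p by simp
    then show ?thesis unfolding f_def by real_asymp
  qed
  then have "\<epsilon> \<longlonglongrightarrow> 0" unfolding \<epsilon>_def by (intro tendsto_mult_right_zero)
  then have "\<forall>\<^sub>F n in sequentially. \<epsilon> n < min 1 (\<eta>\<^sub>0 / 2)" using c by (intro order_tendstoD) auto
  then obtain n\<^sub>0 where n0: "\<And>n. n \<ge> n\<^sub>0 \<Longrightarrow> \<epsilon> n < min 1 (\<eta>\<^sub>0 / 2)"
    by (auto simp: eventually_sequentially)
  \<comment> \<open>From 3 on, ln n is at least 1.\<close>
  define n\<^sub>1 where "n\<^sub>1 = max 3 n\<^sub>0"
  \<comment> \<open>Only net points in this shell have to be cut off. As 2 \<epsilon> is eventually
    at most \<open>\<eta>\<^sub>0\<close>, the shell stays within the range of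
    \<open>separation_rate\<close>.\<close>
  define G' where "G' n = {g \<in> G n. \<epsilon> n / 2 \<le> infdist g K \<and> infdist g K \<le> 2 * \<epsilon> n}" for n
  define E where "E n g = {\<omega> \<in> space M. emeasure (\<xi> \<omega>) ({0..real n} \<times> ?A g) = 0}" for n g
  \<comment> \<open>Taking the empty set for small \<open>n\<close> makes the probability bound hold
    for every \<open>n\<close>.\<close>
  define bad where "bad n = (if n \<ge> n\<^sub>1 then (\<Union>g\<in>G' n. E n g) else {})" for n
  have large: "1 \<le> ln (real n)" "0 < f n" "1 / real n \<le> f n" "0 < \<epsilon> n" "\<epsilon> n \<le> 1" "2 * \<epsilon> n \<le> \<eta>\<^sub>0"
    "c * (\<epsilon> n / 2) powr p * real n \<ge> (real d + 2) * ln (real n)" if n: "n \<ge> n\<^sub>1" for n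
  proof -
    have n3: "3 \<le> real n" using n by (simp add: n\<^sub>1_def)
    have "exp 1 \<le> real n" using exp_le n3 by linarith
    then show l: "1 \<le> ln (real n)" using n3 by (simp add: ln_ge_iff)
    then show fp: "0 < f n" using n3 by (simp add: f_def)
    \<comment> \<open>Since p is at least 1, the mesh 1 / n is no coarser than the claimed
      rate.\<close>
    have "(1 / real n) powr 1 \<le> (1 / real n) powr (1 / p)"
      using n3 p by (intro powr_mono') auto
    also have "\<dots> \<le> f n" unfolding f_def using l n3 p by (intro powr_mono2) (auto simp: divide_right_mono)
    finally show "1 / real n \<le> f n" using n3 by simp
    show "0 < \<epsilon> n" using fp C by (simp add: \<epsilon>_def)
    show "\<epsilon> n \<le> 1" "2 * \<epsilon> n \<le> \<eta>\<^sub>0" using n0[of n] n by (auto simp: n\<^sub>1_def)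
    have "(C / 2) powr 1 \<le> (C / 2) powr p" using C p by (intro powr_mono) auto
    then have "C / 2 \<le> (C / 2) powr p" using C by simp
    moreover have "f n powr p = ln (real n) / real n"
      using l n3 p by (simp add: f_def powr_powr)
    ultimately have "C / 2 * (ln (real n) / real n) \<le> (C / 2) powr p * f n powr p"
      using l n3 mult_right_mono[of "C / 2" "(C / 2) powr p" "ln (real n) / real n"] by simp
    also have "\<dots> = (\<epsilon> n / 2) powr p"
      using C fp by (simp add: \<epsilon>_def flip: powr_mult)
    finally have "c * (C / 2 * (ln (real n) / real n)) * real n \<le> c * (\<epsilon> n / 2) powr p * real n"
      using c by (intro mult_right_mono mult_left_mono) auto
    moreover have "c * (C / 2 * (ln (real n) / real n)) * real n = c * (C / 2) * ln (real n)"
      using n3 by simp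
    moreover have "(real d + 2) * ln (real n) \<le> c * (C / 2) * ln (real n)"
      using C l by (intro mult_right_mono) auto
    ultimately show "c * (\<epsilon> n / 2) powr p * real n \<ge> (real d + 2) * ln (real n)" by linarith
  qed
  have E: "E n g \<in> sets M" "measure M (E n g) \<le> 1 / real n ^ (d + 2)" if n: "n \<ge> n\<^sub>1" and g: "g \<in> G' n" for n g
  proof -
    note ln = large[OF n]
    have g': "\<epsilon> n / 2 \<le> infdist g K" "infdist g K \<le> 2 * \<epsilon> n" using g by (auto simp: G'_def)
    then have gp: "0 < infdist g K" "infdist g K \<le> \<eta>\<^sub>0" using ln by linarith+
    note void = poisson_void_probability_le[OF \<phi> P K(1) ne of_nat_0_le_iff[of n] \<Theta>[OF gp]]
    show "E n g \<in> sets M" using void(1) by (simp add: E_def)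
    have "(\<epsilon> n / 2) powr p \<le> infdist g K powr p" using g' ln p by (intro powr_mono2) auto
    then have "c * (\<epsilon> n / 2) powr p * real n \<le> c * infdist g K powr p * real n"
      using c by (intro mult_right_mono mult_left_mono) auto
    then have "(real d + 2) * ln (real n) \<le> real n * (c * infdist g K powr p)" using ln(7) by (simp add: mult_ac)
    then have "exp (- real n * (c * infdist g K powr p)) \<le> exp (- ((real d + 2) * ln (real n)))" by simp
    also have "(real d + 2) * ln (real n) = ln (real n ^ (d + 2))"
      using n by (subst ln_realpow) (auto simp: n\<^sub>1_def)
    also have "exp (- \<dots>) = 1 / real n ^ (d + 2)"
      using n by (simp add: n\<^sub>1_def exp_minus inverse_eq_divide)
    finally show "measure M (E n g) \<le> 1 / real n ^ (d + 2)" using void(2) by (simp add: E_def)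
  qed
  have finG': "finite (G' n)" if "n \<ge> n\<^sub>1" for n using that G(1)[of n] by (simp add: G'_def n\<^sub>1_def)
  have bad_sets: "bad n \<in> sets M" for n
    using E(1) finG' by (auto simp: bad_def)
  have bad_prob: "measure M (bad n) \<le> real (2 * R + 1) ^ d * inverse (real n ^ 2)" for n
  proof (cases "n \<ge> n\<^sub>1")
    case True
    have n1: "1 \<le> n" using True by (simp add: n\<^sub>1_def)
    have "measure M (bad n) \<le> (\<Sum>g\<in>G' n. measure M (E n g))"
      using True E(1) finG' by (auto simp: bad_def intro!: M.finite_measure_subadditive_finite)
    also have "\<dots> \<le> (\<Sum>g\<in>G' n. 1 / real n ^ (d + 2))" using E(2) True by (intro sum_mono)
    also have "\<dots> = real (card (G' n)) * (1 / real n ^ (d + 2))" by simp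
    also have "\<dots> \<le> (real (2 * R + 1) * real n) ^ d * (1 / real n ^ (d + 2))"
    proof (rule mult_right_mono)
      have "card (G' n) \<le> card (G n)" using G(1)[OF n1] by (intro card_mono) (auto simp: G'_def)
      then show "real (card (G' n)) \<le> (real (2 * R + 1) * real n) ^ d" using G(2)[OF n1] by linarith
    qed simp
    also have "\<dots> = real (2 * R + 1) ^ d * inverse (real n ^ 2)"
      using n1 unfolding power_mult_distrib power_add by (simp add: field_simps)
    finally show ?thesis .
  qed (simp add: bad_def)
  have "summable (\<lambda>n. measure M (bad n))"
  proof (rule summable_comparison_test')
    show "summable (\<lambda>n. real (2 * R + 1) ^ d * inverse (real n ^ 2))"
      by (intro summable_mult inverse_power_summable) simp
    show "norm (measure M (bad n)) \<le> real (2 * R + 1) ^ d * inverse (real n ^ 2)" if "n \<ge> 0" for n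
      using bad_prob by simp
  qed
  then have "AE \<omega> in M. \<forall>\<^sub>F n in sequentially. \<omega> \<in> space M - bad n"
    using bad_sets by (intro borel_cantelli_AE1) (auto simp: less_top[symmetric])
  then have "AE \<omega> in M. \<forall>\<^sub>F n in sequentially.
    hausdorff_distance K (K_cell K (hyperplane_process (real n) (\<xi> \<omega>))) \<le> C * f n"
  proof (rule AE_mp, intro AE_I2 impI)
    fix \<omega> assume "\<omega> \<in> space M" and ev: "\<forall>\<^sub>F n in sequentially. \<omega> \<in> space M - bad n"
    have \<nu>: "sets (\<xi> \<omega>) = sets (restrict_space lborel {0..} \<Otimes>\<^sub>M hyperplane_measure \<phi> 1)"
      using P \<open>\<omega> \<in> space M\<close> unfolding poisson_process_def by blast
    show "\<forall>\<^sub>F n in sequentially. hausdorff_distance K (K_cell K (hyperplane_process (real n) (\<xi> \<omega>))) \<le> C * f n"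
      using ev eventually_ge_at_top[of n\<^sub>1]
    proof eventually_elim
      fix n assume good: "\<omega> \<in> space M - bad n" and n: "n\<^sub>1 \<le> n"
      note ln = large[OF n]
      have n1: "1 \<le> n" using n by (simp add: n\<^sub>1_def)
      have "hausdorff_distance K (K_cell K (hyperplane_process (real n) (\<xi> \<omega>))) \<le> \<epsilon> n"
      proof (rule hausdorff_distance_K_cell_le[where G = "G n"])
        show "hyperplane_process (real n) (\<xi> \<omega>) \<subseteq> hyperplanes" by (rule hyperplane_process_subset)
        show "\<exists>g\<in>G n. dist g w \<le> r / (4 * (D + 1)) * \<epsilon> n" if w: "dist z w \<le> D + 1" for w
        proof -
          have "norm w \<le> norm z + dist z w" using norm_triangle_sub[of w z] by (simp add: dist_norm norm_minus_commute)
          then obtain g where g: "g \<in> G n" "dist g w \<le> real d / real n" using G(3)[OF n1, of w] w R by auto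
          have "real d * (1 / real n) \<le> \<kappa> * C * f n"
            using C ln by (intro mult_mono) auto
          then have "real d / real n \<le> \<kappa> * \<epsilon> n" by (simp add: \<epsilon>_def mult.assoc)
          then show ?thesis using g unfolding \<kappa>_def by (meson order_trans)
        qed
        show "g \<notin> K_cell K (hyperplane_process (real n) (\<xi> \<omega>))"
          if g: "g \<in> G n" "\<epsilon> n / 2 \<le> infdist g K" "infdist g K \<le> 2 * \<epsilon> n" for g
        proof -
          have "g \<in> G' n" using g by (simp add: G'_def)
          then have "\<omega> \<notin> E n g" using good n by (auto simp: bad_def)
          then have "emeasure (\<xi> \<omega>) ({0..real n} \<times> ?A g) \<noteq> 0"
            using \<open>\<omega> \<in> space M\<close> by (simp add: E_def)
          then show ?thesis by (intro K_cell_excludes[OF \<nu> K(1) ne]) auto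
        qed
      qed (use ln in auto)
      then show "hausdorff_distance K (K_cell K (hyperplane_process (real n) (\<xi> \<omega>))) \<le> C * f n"
        by (simp add: \<epsilon>_def)
    qed
  qed
  then show ?thesis unfolding almost_surely_bigo_def f_def by blast
qed

section \<open>Assembly of the three rates\<close>

lemma convex_body_nested_balls:
  assumes "convex_body K" "2 \<le> DIM('a)"
  obtains z :: "'a::euclidean_space" and r D where "nested_balls K z r D"
proof -
  obtain z where "z \<in> interior K" using assms by (auto simp: convex_body_def)
  then obtain r where "0 < r" "cball z r \<subseteq> K" by (auto simp: mem_interior_cball)
  moreover have "bounded K" using assms by (auto simp: convex_body_def compact_imp_bounded)
  then obtain D where "K \<subseteq> cball z D" using bounded_subset_cball bounded_any_center[of K z]
    by (auto simp: subset_eq)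
  ultimately show ?thesis using that assms by (auto simp: nested_balls_def convex_body_def)
qed

theorem theorem2:
  fixes K :: "'a::euclidean_space set"
    and \<phi> :: "'a measure"
    and M :: "'w measure"
    and \<xi> :: "'w \<Rightarrow> (real \<times> 'a set) measure"
  assumes "DIM('a) \<ge> 2"
    and "convex_body K"
    and "prob_space \<phi>" "sets \<phi> = sets sphere_borel"
    and "even_measure \<phi>"
    and "\<not> concentrated_on_great_subsphere \<phi>"
    and "poisson_process M
      (prod_topology (top_of_set {0..}) hyperplane_topology)
      (restrict_space lborel {0..} \<Otimes>\<^sub>M hyperplane_measure \<phi> 1) \<xi>"
  shows
    "((\<exists>b>0. setwise_ge \<phi> b spherical_lebesgue \<or> setwise_ge \<phi> b (surface_area_measure K)) \<longrightarrow>
       almost_surely_bigo M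
         (\<lambda>n \<omega>. hausdorff_distance K (K_cell K (hyperplane_process (real n) (\<xi> \<omega>))))
         (\<lambda>n. (ln (real n) / real n) powr (1 / real DIM('a)))) \<and>
     ((\<exists>b>0. setwise_ge \<phi> b (surface_area_measure K)) \<longrightarrow>
       ((\<exists>c r. r > 0 \<and> slides_freely_inside (cball c r) K) \<longrightarrow>
         almost_surely_bigo M
           (\<lambda>n \<omega>. hausdorff_distance K (K_cell K (hyperplane_process (real n) (\<xi> \<omega>))))
           (\<lambda>n. (ln (real n) / real n) powr (2 / (real DIM('a) + 1)))) \<and>
       (polytope K \<longrightarrow>
         almost_surely_bigo M
           (\<lambda>n \<omega>. hausdorff_distance K (K_cell K (hyperplane_process (real n) (\<xi> \<omega>))))
           (\<lambda>n. (ln (real n) / real n) powr 1)))"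
proof -
  obtain z r D where "nested_balls K z r D"
    using convex_body_nested_balls[OF assms(2,1)] .
  then interpret nested_balls K z r D .
  note rate = K_cell_rate[OF assms(3,4,5,7)]
  show ?thesis
  proof (intro conjI impI)
    assume "\<exists>b>0. setwise_ge \<phi> b spherical_lebesgue \<or> setwise_ge \<phi> b (surface_area_measure K)"
    then have "separation_rate K \<phi> (real DIM('a))"
      using separation_rate_sphere[OF assms(4)] separation_rate_surface[OF assms(4)] by blast
    from rate[OF this] show "almost_surely_bigo M
        (\<lambda>n \<omega>. hausdorff_distance K (K_cell K (hyperplane_process (real n) (\<xi> \<omega>))))
        (\<lambda>n. (ln (real n) / real n) powr (1 / real DIM('a)))"
      using assms(1) by simp
  next
    assume "\<exists>b>0. setwise_ge \<phi> b (surface_area_measure K)" "\<exists>c r. r > 0 \<and> slides_freely_inside (cball c r) K"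
    then have "separation_rate K \<phi> ((real DIM('a) + 1) / 2)"
      using separation_rate_smooth[OF assms(4)] by blast
    from rate[OF this] show "almost_surely_bigo M
        (\<lambda>n \<omega>. hausdorff_distance K (K_cell K (hyperplane_process (real n) (\<xi> \<omega>))))
        (\<lambda>n. (ln (real n) / real n) powr (2 / (real DIM('a) + 1)))"
      using assms(1) by simp
  next
    assume "\<exists>b>0. setwise_ge \<phi> b (surface_area_measure K)" "polytope K"
    then have "separation_rate K \<phi> 1"
      using separation_rate_polytope[OF assms(3,4)] by blast
    from rate[OF this] show "almost_surely_bigo M
        (\<lambda>n \<omega>. hausdorff_distance K (K_cell K (hyperplane_process (real n) (\<xi> \<omega>))))
        (\<lambda>n. (ln (real n) / real n) powr 1)"
      by simp
  qed
qed

end
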